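(* Let $Lx=y$ be given, where $L=(a_{k-l})_{k,l\in\mathbb Z}$ is a hermitian positive definite biinfinite Toeplitz matrix and $y=(y_k)_{k\in\mathbb Z}\in\ell^2(\mathbb Z)$. For $n\ge1$ let $L_n=(a_{k-l})_{k,l=-n+1}^{n-1}$, $y^{(n)}=(y_k)_{k=-n+1}^{n-1}$ and $x^{(n)}=L_n^{-1}y^{(n)}$. (a) If there exist constants $c,c'$ such that $$|a_k|\le c\,e^{-\gamma|k|}\quad\text{and}\quad |y_k|\le c'\,e^{-\gamma|k|},\qquad \gamma>0,$$ for all $k\in\mathbb Z$, then there exist a $\gamma_1$ with $0<\gamma_1<\gamma$ and a constant $c_1$ depending only on $\gamma_1$ and on the condition number of $L$ such that $$\|x-x^{(n)}\|\le c_1\,e^{-\gamma_1 n}.$$ (b) If there exist constants $c,c'$ such that $$|a_k|\le c\,(1+|k|)^{-s}\quad\text{and}\quad |y_k|\le c'\,(1+|k|)^{-s},\qquad s>1,$$ for all $k\in\mathbb Z$, then there exists a constant $c_1$ depending only on the condition number of $L$ such that $$\|x-x^{(n)}\|\le c_1\,n^{(1-2s)/2}.$$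
   Context: Biinfinite Toeplitz matrices act as bounded operators on $\ell^2(\mathbb Z)$; hermitian positive definite means self-adjoint, positive and boundedly invertible on $\ell^2(\mathbb Z)$. The condition number of $L$ is $\|L\|\,\|L^{-1}\|$ with operator norms on $\ell^2(\mathbb Z)$. The norm $\|\cdot\|$ of a vector is the $\ell^2$-norm. The finite vector $x^{(n)}\in\mathbb C^{2n-1}$ (indexed by $-n+1,\dots,n-1$) is identified with the element of $\ell^2(\mathbb Z)$ obtained by extending it by zero. Since $L$ is hermitian positive definite, every $L_n$ is hermitian positive definite, hence invertible.
   Formalization: In (b) the constant c_1 may depend on s, c, c' and the norm of L as well as on its condition number; with dependence on the condition number alone the claim fails, since scaling y scales the error. *)

theory Defs
  imports
    "HOL-Analysis.Infinite_Sum"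
    "HOL-Analysis.L2_Norm"
    "HOL-Analysis.Operator_Norm"
    "Jordan_Normal_Form.Gauss_Jordan_Elimination"
begin

section \<open>The space of square-summable biinfinite complex sequences\<close>

lemma sq_summable_add:
  fixes f g :: "int \<Rightarrow> complex"
  assumes "(\<lambda>k. (cmod (f k))\<^sup>2) summable_on UNIV" "(\<lambda>k. (cmod (g k))\<^sup>2) summable_on UNIV"
  shows "(\<lambda>k. (cmod (f k + g k))\<^sup>2) summable_on UNIV"
proof (rule summable_on_comparison_test)
  show "(\<lambda>k. 2 * (cmod (f k))\<^sup>2 + 2 * (cmod (g k))\<^sup>2) summable_on UNIV"
    by (intro summable_on_add summable_on_cmult_right assms)
  fix k :: int
  have "(cmod (f k + g k))\<^sup>2 \<le> (cmod (f k) + cmod (g k))\<^sup>2"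
    by (intro power_mono norm_triangle_ineq norm_ge_zero)
  also have "\<dots> \<le> 2 * (cmod (f k))\<^sup>2 + 2 * (cmod (g k))\<^sup>2"
    using zero_le_power2[of "cmod (f k) - cmod (g k)"]
    by (simp add: power2_sum power2_diff)
  finally show "(cmod (f k + g k))\<^sup>2 \<le> 2 * (cmod (f k))\<^sup>2 + 2 * (cmod (g k))\<^sup>2" .
qed simp

typedef ell2 = "{f :: int \<Rightarrow> complex. (\<lambda>k. (cmod (f k))\<^sup>2) summable_on UNIV}"
  morphisms ell2_nth Abs_ell2
  by (rule exI[of _ "\<lambda>_. 0"]) simp

setup_lifting type_definition_ell2

lemma ell2_eqI: "(\<And>k. ell2_nth x k = ell2_nth y k) \<Longrightarrow> x = y"
  by (metis ell2_nth_inject ext)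

lemma ell2_summable: "(\<lambda>k. (cmod (ell2_nth x k))\<^sup>2) summable_on UNIV"
  using ell2_nth[of x] by simp

instantiation ell2 :: real_vector
begin

lift_definition zero_ell2 :: ell2 is "\<lambda>_. 0" by simp

lift_definition plus_ell2 :: "ell2 \<Rightarrow> ell2 \<Rightarrow> ell2" is "\<lambda>f g k. f k + g k"
  by (rule sq_summable_add)

lift_definition uminus_ell2 :: "ell2 \<Rightarrow> ell2" is "\<lambda>f k. - f k" by simp

lift_definition minus_ell2 :: "ell2 \<Rightarrow> ell2 \<Rightarrow> ell2" is "\<lambda>f g k. f k - g k"
  subgoal for f g using sq_summable_add[of f "\<lambda>k. - g k"] by simp
  done

lift_definition scaleR_ell2 :: "real \<Rightarrow> ell2 \<Rightarrow> ell2" is "\<lambda>r f k. r *\<^sub>R f k"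
  by (simp add: power_mult_distrib summable_on_cmult_right)

instance
  by standard (transfer; simp add: fun_eq_iff algebra_simps)+

end

instantiation ell2 :: real_normed_vector
begin

definition norm_ell2 :: "ell2 \<Rightarrow> real" where
  "norm x = sqrt (\<Sum>\<^sub>\<infinity>k. (cmod (ell2_nth x k))\<^sup>2)"

definition sgn_ell2 :: "ell2 \<Rightarrow> ell2" where "sgn_ell2 x = x /\<^sub>R norm x"

definition dist_ell2 :: "ell2 \<Rightarrow> ell2 \<Rightarrow> real" where "dist_ell2 x y = norm (x - y)"

definition uniformity_ell2 :: "(ell2 \<times> ell2) filter" where
  "uniformity_ell2 = (INF e\<in>{0<..}. principal {(x, y). dist x y < e})"

definition open_ell2 :: "ell2 set \<Rightarrow> bool" where
  "open_ell2 U \<longleftrightarrow> (\<forall>x\<in>U. \<forall>\<^sub>F (x', y) in uniformity. x' = x \<longrightarrow> y \<in> U)"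

lemma L2_set_le_norm_ell2:
  assumes "finite F"
  shows "L2_set (\<lambda>k. cmod (ell2_nth x k)) F \<le> norm x"
  unfolding L2_set_def norm_ell2_def
  by (intro real_sqrt_le_mono finite_sum_le_infsum ell2_summable assms) auto

lemma norm_ell2_le:
  assumes "\<And>F. finite F \<Longrightarrow> L2_set (\<lambda>k. cmod (ell2_nth x k)) F \<le> B"
  shows "norm x \<le> B"
proof -
  have B0: "0 \<le> B" using assms[of "{}"] by simp
  have "(\<Sum>\<^sub>\<infinity>k. (cmod (ell2_nth x k))\<^sup>2) \<le> B\<^sup>2"
  proof (rule infsum_le_finite_sums[OF ell2_summable])
    fix F :: "int set" assume "finite F"
    from assms[OF this] show "(\<Sum>k\<in>F. (cmod (ell2_nth x k))\<^sup>2) \<le> B\<^sup>2"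
      unfolding L2_set_def by (metis B0 real_sqrt_le_iff real_sqrt_unique)
  qed
  then show ?thesis
    unfolding norm_ell2_def by (metis B0 real_sqrt_le_iff real_sqrt_unique)
qed

instance
proof
  fix x y :: ell2 and r :: real
  show "(norm x = 0) = (x = 0)"
  proof
    assume "norm x = 0"
    have "ell2_nth x k = 0" for k
      using L2_set_le_norm_ell2[of "{k}" x] \<open>norm x = 0\<close> by simp
    then show "x = 0" by (intro ell2_eqI) (simp add: zero_ell2.rep_eq)
  qed (simp add: norm_ell2_def zero_ell2.rep_eq)
  show "norm (x + y) \<le> norm x + norm y"
  proof (rule norm_ell2_le)
    fix F :: "int set" assume F: "finite F"
    have "L2_set (\<lambda>k. cmod (ell2_nth (x + y) k)) F
        \<le> L2_set (\<lambda>k. cmod (ell2_nth x k) + cmod (ell2_nth y k)) F"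
      by (rule L2_set_mono) (auto simp: plus_ell2.rep_eq norm_triangle_ineq)
    also have "\<dots> \<le> L2_set (\<lambda>k. cmod (ell2_nth x k)) F + L2_set (\<lambda>k. cmod (ell2_nth y k)) F"
      by (rule L2_set_triangle_ineq)
    also have "\<dots> \<le> norm x + norm y"
      by (intro add_mono L2_set_le_norm_ell2 F)
    finally show "L2_set (\<lambda>k. cmod (ell2_nth (x + y) k)) F \<le> norm x + norm y" .
  qed
  show "norm (r *\<^sub>R x) = \<bar>r\<bar> * norm x"
    by (simp add: norm_ell2_def scaleR_ell2.rep_eq power_mult_distrib infsum_cmult_right'
        real_sqrt_mult)
qed (simp_all add: sgn_ell2_def dist_ell2_def uniformity_ell2_def open_ell2_def)

end

definition cinner_ell2 :: "ell2 \<Rightarrow> ell2 \<Rightarrow> complex" where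
  "cinner_ell2 x y = (\<Sum>\<^sub>\<infinity>k. ell2_nth x k * cnj (ell2_nth y k))"


section \<open>Biinfinite Toeplitz operators\<close>

text \<open>\<open>bounded_linear\<close> is real-linear, but the matrix representation makes
  \<open>L\<close> complex-linear and determines it uniquely from \<open>a\<close>.\<close>

definition toeplitz_operator :: "(int \<Rightarrow> complex) \<Rightarrow> (ell2 \<Rightarrow> ell2) \<Rightarrow> bool" where
  "toeplitz_operator a L \<longleftrightarrow> bounded_linear L \<and>
     (\<forall>x k. ((\<lambda>l. a (k - l) * ell2_nth x l) has_sum ell2_nth (L x) k) UNIV)"

(* inv_into UNIV is the function inverse; the short form inv is the group inverse of HOL-Algebra here. *)

definition hermitian_positive_definite :: "(ell2 \<Rightarrow> ell2) \<Rightarrow> bool" where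
  "hermitian_positive_definite L \<longleftrightarrow>
     (\<forall>x y. cinner_ell2 (L x) y = cinner_ell2 x (L y)) \<and>
     (\<forall>x. 0 \<le> Re (cinner_ell2 (L x) x)) \<and>
     bij L \<and> bounded_linear (inv_into UNIV L)"

definition condition_number :: "(ell2 \<Rightarrow> ell2) \<Rightarrow> real" where
  "condition_number L = onorm L * onorm (inv_into UNIV L)"


section \<open>Finite sections\<close>

text \<open>Matrix and vector types are indexed from \<open>0\<close>, so the position
  \<open>i < 2 * n - 1\<close> stands for the index \<open>i - n + 1\<close> in \<open>{-n+1..n-1}\<close>.\<close>

definition section_matrix :: "(int \<Rightarrow> complex) \<Rightarrow> nat \<Rightarrow> complex mat" where
  "section_matrix a n = mat (2 * n - 1) (2 * n - 1)
     (\<lambda>(i, j). a ((int i - int n + 1) - (int j - int n + 1)))"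

definition section_vector :: "ell2 \<Rightarrow> nat \<Rightarrow> complex vec" where
  "section_vector y n = vec (2 * n - 1) (\<lambda>i. ell2_nth y (int i - int n + 1))"

lift_definition extend_by_zero :: "nat \<Rightarrow> complex vec \<Rightarrow> ell2" is
  "\<lambda>n v k. if - int n + 1 \<le> k \<and> k \<le> int n - 1 then v $ nat (k + int n - 1) else 0"
  subgoal for n v
    by (rule iffD1[OF summable_on_cong_neutral[of UNIV "{- int n + 1..int n - 1}"] summable_on_finite])
      auto
  done

definition section_solution :: "(int \<Rightarrow> complex) \<Rightarrow> ell2 \<Rightarrow> nat \<Rightarrow> ell2" where
  "section_solution a y n =
     extend_by_zero n (the (mat_inverse (section_matrix a n)) *\<^sub>v section_vector y n)"

end

theory Submission
  imports Defs "HOL-Analysis.Elementary_Normed_Spaces" "HOL-Analysis.Summation_Tests"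
    "Jordan_Normal_Form.Determinant"
begin

text \<open>By positivity of \<open>L\<close> the finite section error is at most \<open>1 + condition_number L\<close> times the
  norm of the tail of \<open>x\<close>, so everything rests on the decay of \<open>x\<close>. For a multiplier \<open>\<phi>\<close> we have
  \<open>\<parallel>\<phi> x\<parallel> \<le> \<parallel>L\<^sup>-\<^sup>1\<parallel> (\<parallel>\<phi> y\<parallel> + \<parallel>[L, \<phi>] x\<parallel>)\<close>. With a slowly growing truncated exponential \<open>\<phi>\<close> the
  commutator is a small multiple of \<open>\<parallel>\<phi> x\<parallel>\<close> and can be absorbed, which gives exponential decay. With
  a cutoff \<open>\<phi>\<close> between \<open>2 * N\<close> and \<open>4 * N\<close> the commutator is bounded by a small multiple of the tail
  beyond \<open>N\<close> plus \<open>N powr (1 / 2 - s)\<close> times the sum of the \<open>\<bar>x\<^sub>l\<bar>\<close> with \<open>\<bar>l\<bar> < N\<close>; iterating over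
  \<open>N = 4 ^ j\<close> gives polynomial decay. In part (a) the rate \<open>\<gamma>\<^sub>1\<close> may depend on all the data, so
  the constant can be taken to be \<open>1 / \<gamma>\<^sub>1\<close> after decreasing \<open>\<gamma>\<^sub>1\<close>.\<close>

section \<open>Multipliers, convolutions and commutators\<close>

lemma ell2_nth_le_norm: "cmod (ell2_nth x k) \<le> norm x"
  using L2_set_le_norm_ell2[of "{k}" x] by simp

text \<open>The majorant \<open>h\<close> enters only through finite sets of indices, so sums and
  convolutions can serve as majorants without being packaged as elements of
  \<open>ell2\<close>.\<close>

lemma norm_ell2_le_L2_set:
  assumes "\<And>k. cmod (ell2_nth x k) \<le> h k" "\<And>F. finite F \<Longrightarrow> L2_set h F \<le> H"
  shows "norm x \<le> H"
proof (rule norm_ell2_le)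
  fix F :: "int set" assume "finite F"
  have "L2_set (\<lambda>k. cmod (ell2_nth x k)) F \<le> L2_set h F"
    by (intro L2_set_mono assms) auto
  then show "L2_set (\<lambda>k. cmod (ell2_nth x k)) F \<le> H" using assms(2)[OF \<open>finite F\<close>] by linarith
qed

lemma norm_ell2_mono:
  assumes "\<And>k. cmod (ell2_nth x k) \<le> cmod (ell2_nth y k)"
  shows "norm x \<le> norm y"
  using assms L2_set_le_norm_ell2 by (rule norm_ell2_le_L2_set)

text \<open>The integers are covered by the values \<open>int n\<close> and \<open>- int n\<close>;
  that 0 is covered twice does no harm to summability.\<close>

lemma summable_on_nat_abs:
  fixes h :: "nat \<Rightarrow> real"
  assumes "summable h" "\<And>n. 0 \<le> h n"
  shows "(\<lambda>k::int. h (nat \<bar>k\<bar>)) summable_on UNIV"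
proof -
  have h: "h summable_on UNIV"
    using assms by (intro norm_summable_imp_summable_on) simp
  have "(\<lambda>k::int. h (nat \<bar>k\<bar>)) summable_on range int"
    using h by (subst summable_on_reindex) (auto simp: o_def)
  moreover have "(\<lambda>k::int. h (nat \<bar>k\<bar>)) summable_on range (\<lambda>n. - int n)"
    using h by (subst summable_on_reindex) (auto simp: o_def inj_on_def)
  ultimately have "(\<lambda>k::int. h (nat \<bar>k\<bar>)) summable_on (range int \<union> range (\<lambda>n. - int n))"
    by (rule summable_on_union)
  moreover have "range int \<union> range (\<lambda>n. - int n) = UNIV"
    by (auto intro: int_cases2)
  ultimately show ?thesis by simp
qed

text \<open>Multiplication by an unbounded sequence does not preserve square summability; such
  multipliers act as zero.\<close>

lift_definition ell2_mult :: "(int \<Rightarrow> real) \<Rightarrow> ell2 \<Rightarrow> ell2" is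
  "\<lambda>\<phi> f k. if bounded (range \<phi>) then complex_of_real (\<phi> k) * f k else 0"
proof -
  fix \<phi> :: "int \<Rightarrow> real" and f :: "int \<Rightarrow> complex"
  assume f: "(\<lambda>k. (cmod (f k))\<^sup>2) summable_on UNIV"
  show "(\<lambda>k. (cmod (if bounded (range \<phi>) then complex_of_real (\<phi> k) * f k else 0))\<^sup>2) summable_on UNIV"
  proof (cases "bounded (range \<phi>)")
    case True
    then obtain B where B: "\<And>k. \<bar>\<phi> k\<bar> \<le> B" unfolding bounded_iff by auto
    have "(\<lambda>k. (cmod (complex_of_real (\<phi> k) * f k))\<^sup>2) summable_on UNIV"
    proof (rule summable_on_comparison_test)
      show "(\<lambda>k. B\<^sup>2 * (cmod (f k))\<^sup>2) summable_on UNIV"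
        by (intro summable_on_cmult_right f)
      show "(cmod (complex_of_real (\<phi> k) * f k))\<^sup>2 \<le> B\<^sup>2 * (cmod (f k))\<^sup>2" for k
        using power_mono[OF B[of k], of 2]
        by (auto simp: norm_mult power_mult_distrib intro!: mult_right_mono)
    qed simp
    then show ?thesis using True by simp
  qed simp
qed

lemma ell2_nth_mult:
  "bounded (range \<phi>) \<Longrightarrow> ell2_nth (ell2_mult \<phi> x) k = complex_of_real (\<phi> k) * ell2_nth x k"
  by (simp add: ell2_mult.rep_eq)

text \<open>The cutoff starts at \<open>int n\<close>, so the tail lives exactly on the complement
  of the indices -n+1, ..., n-1 of the section of order \<open>n\<close>.\<close>

definition ell2_tail :: "nat \<Rightarrow> ell2 \<Rightarrow> ell2" where
  "ell2_tail n x = ell2_mult (\<lambda>k. if int n \<le> \<bar>k\<bar> then 1 else 0) x"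

lemma ell2_nth_tail: "ell2_nth (ell2_tail n x) k = (if int n \<le> \<bar>k\<bar> then ell2_nth x k else 0)"
proof -
  have "bounded (range (\<lambda>k. if int n \<le> \<bar>k\<bar> then 1 else 0 :: real))"
    unfolding bounded_iff by (intro exI[of _ 1]) auto
  then show ?thesis unfolding ell2_tail_def by (simp add: ell2_nth_mult)
qed

lemma norm_ell2_tail_le: "norm (ell2_tail n x) \<le> norm x"
  by (rule norm_ell2_mono) (simp add: ell2_nth_tail)

lemma norm_ell2_tail_antimono: "m \<le> n \<Longrightarrow> norm (ell2_tail n x) \<le> norm (ell2_tail m x)"
  by (rule norm_ell2_mono) (simp add: ell2_nth_tail)

text \<open>Young's inequality for a finitely supported kernel: a shift does not increase the norm,
  and the triangle inequality adds up the shifts with weights \<open>b j\<close>.\<close>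

lemma L2_set_convolution_finite:
  assumes "finite J" "finite F" "\<And>j. 0 \<le> b j"
  shows "L2_set (\<lambda>k. \<Sum>j\<in>J. b j * cmod (ell2_nth x (k - j))) F \<le> (\<Sum>j\<in>J. b j) * norm x"
  using assms(1)
proof (induction J)
  case (insert i J)
  have "L2_set (\<lambda>k. cmod (ell2_nth x (k - i))) F = L2_set (\<lambda>k. cmod (ell2_nth x k)) ((\<lambda>k. k - i) ` F)"
    unfolding L2_set_def by (subst sum.reindex) (auto simp: o_def inj_on_def)
  also have "\<dots> \<le> norm x" using assms(2) by (intro L2_set_le_norm_ell2) auto
  finally have 1: "L2_set (\<lambda>k. b i * cmod (ell2_nth x (k - i))) F \<le> b i * norm x"
    using assms(3)[of i] by (simp add: L2_set_right_distrib[symmetric] mult_left_mono)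
  have "L2_set (\<lambda>k. \<Sum>j\<in>insert i J. b j * cmod (ell2_nth x (k - j))) F
      = L2_set (\<lambda>k. b i * cmod (ell2_nth x (k - i)) + (\<Sum>j\<in>J. b j * cmod (ell2_nth x (k - j)))) F"
    using insert by simp
  also have "\<dots> \<le> L2_set (\<lambda>k. b i * cmod (ell2_nth x (k - i))) F
      + L2_set (\<lambda>k. \<Sum>j\<in>J. b j * cmod (ell2_nth x (k - j))) F"
    by (rule L2_set_triangle_ineq)
  also have "\<dots> \<le> b i * norm x + (\<Sum>j\<in>J. b j) * norm x"
    using 1 insert by linarith
  finally show ?case using insert by (simp add: algebra_simps)
qed (simp add: L2_set_def)

lemma convolution_summable:
  assumes "b summable_on UNIV" "\<And>j. (0::real) \<le> b j"
  shows "(\<lambda>j. b j * cmod (ell2_nth x (k - j))) summable_on UNIV"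
  by (rule summable_on_comparison_test[where f = "\<lambda>j. b j * norm x"])
    (auto intro!: summable_on_cmult_left assms mult_left_mono ell2_nth_le_norm simp: assms)

text \<open>The finite case passes to the limit along the finite sets \<open>J\<close>. Since
  \<open>F\<close> stays fixed and finite, the limit may be taken inside
  \<open>L2_set\<close>.\<close>

lemma L2_set_convolution:
  assumes b: "b summable_on UNIV" "\<And>j. (0::real) \<le> b j" and F: "finite F"
  shows "L2_set (\<lambda>k. \<Sum>\<^sub>\<infinity>j. b j * cmod (ell2_nth x (k - j))) F \<le> (\<Sum>\<^sub>\<infinity>j. b j) * norm x"
proof (rule tendsto_upperbound)
  show "((\<lambda>J. L2_set (\<lambda>k. \<Sum>j\<in>J. b j * cmod (ell2_nth x (k - j))) F) \<longlongrightarrow>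
      L2_set (\<lambda>k. \<Sum>\<^sub>\<infinity>j. b j * cmod (ell2_nth x (k - j))) F) (finite_subsets_at_top UNIV)"
    unfolding L2_set_def
    by (intro tendsto_intros infsum_tendsto convolution_summable b)
  show "\<forall>\<^sub>F J in finite_subsets_at_top UNIV.
      L2_set (\<lambda>k. \<Sum>j\<in>J. b j * cmod (ell2_nth x (k - j))) F \<le> (\<Sum>\<^sub>\<infinity>j. b j) * norm x"
  proof (rule eventually_finite_subsets_at_top_weakI)
    fix J :: "int set" assume J: "finite J"
    have "L2_set (\<lambda>k. \<Sum>j\<in>J. b j * cmod (ell2_nth x (k - j))) F \<le> (\<Sum>j\<in>J. b j) * norm x"
      by (rule L2_set_convolution_finite[OF J F b(2)])
    also have "\<dots> \<le> (\<Sum>\<^sub>\<infinity>j. b j) * norm x"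
      by (intro mult_right_mono finite_sum_le_infsum b J) auto
    finally show "L2_set (\<lambda>k. \<Sum>j\<in>J. b j * cmod (ell2_nth x (k - j))) F \<le> (\<Sum>\<^sub>\<infinity>j. b j) * norm x" .
  qed
qed simp

lemma toeplitz_sum:
  "toeplitz_operator a L \<Longrightarrow> ((\<lambda>l. a (k - l) * ell2_nth x l) has_sum ell2_nth (L x) k) UNIV"
  unfolding toeplitz_operator_def by blast

lemma convolution_has_sum:
  assumes "b summable_on UNIV" "\<And>j. (0::real) \<le> b j"
  shows "((\<lambda>l. b (k - l) * cmod (ell2_nth x l)) has_sum (\<Sum>\<^sub>\<infinity>j. b j * cmod (ell2_nth x (k - j)))) UNIV"
proof -
  have "((\<lambda>j. b j * cmod (ell2_nth x (k - j))) has_sum (\<Sum>\<^sub>\<infinity>j. b j * cmod (ell2_nth x (k - j)))) UNIV"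
    by (intro has_sum_infsum convolution_summable assms)
  then show ?thesis
    by (subst has_sum_reindex_bij_witness[where i = "\<lambda>j. k - j" and j = "\<lambda>l. k - l" and T = UNIV]) auto
qed

text \<open>The hypothesis \<open>comm\<close> bounds the entries of the commutator of \<open>L\<close> with multiplication
  by \<open>\<phi>\<close>.\<close>

lemma commutator_estimate:
  assumes L: "toeplitz_operator a L" and M: "\<And>u. norm u \<le> M * norm (L u)" "0 \<le> M"
    and \<phi>: "bounded (range \<phi>)"
    and b: "b summable_on UNIV" "\<And>j. 0 \<le> b j"
    and e: "(e has_sum S) UNIV"
    and comm: "\<And>k l. cmod (a (k - l)) * \<bar>\<phi> k - \<phi> l\<bar> * cmod (ell2_nth x l)
      \<le> b (k - l) * cmod (ell2_nth f l) + g k * e l"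
    and h: "\<And>k. \<bar>\<phi> k\<bar> * cmod (ell2_nth (L x) k) + g k * S \<le> h k"
    and H: "\<And>F. finite F \<Longrightarrow> L2_set h F \<le> H"
  shows "norm (ell2_mult \<phi> x) \<le> M * ((\<Sum>\<^sub>\<infinity>j. b j) * norm f + H)"
proof -
  let ?u = "ell2_mult \<phi> x"
  \<comment> \<open>The commutator bound has two parts: the convolution of \<open>b\<close> with
    \<open>f\<close> contributes \<open>B k\<close>, while the rank-one part
    \<open>g k * e l\<close> sums over \<open>l\<close> to \<open>g k * S\<close>, which
    \<open>h\<close> collects together with \<phi> times \<open>L x\<close>.\<close>
  define B where "B k = (\<Sum>\<^sub>\<infinity>j. b j * cmod (ell2_nth f (k - j)))" for k
  have "cmod (ell2_nth (L ?u) k) \<le> B k + h k" for k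
  proof -
    let ?c = "\<lambda>l. a (k - l) * (complex_of_real (\<phi> k) - complex_of_real (\<phi> l)) * ell2_nth x l"
    let ?d = "\<lambda>l. b (k - l) * cmod (ell2_nth f l) + g k * e l"
    \<comment> \<open>Subtracting the row sums of \<open>L (\<phi> x)\<close> from those of
      \<open>\<phi> (L x)\<close> leaves the entries
      \<open>a (k - l) * (\<phi> k - \<phi> l)\<close> acting on \<open>x\<close>.\<close>
    have "((\<lambda>l. complex_of_real (\<phi> k) * (a (k - l) * ell2_nth x l) + - (a (k - l) * ell2_nth ?u l))
        has_sum (complex_of_real (\<phi> k) * ell2_nth (L x) k + - ell2_nth (L ?u) k)) UNIV"
      using toeplitz_sum[OF L, of k x] toeplitz_sum[OF L, of k ?u]
      by (intro has_sum_add has_sum_cmult_right) (simp_all add: has_sum_uminus)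
    then have c: "(?c has_sum (complex_of_real (\<phi> k) * ell2_nth (L x) k - ell2_nth (L ?u) k)) UNIV"
      by (simp add: ell2_nth_mult[OF \<phi>] algebra_simps)
    have d: "(?d has_sum (B k + g k * S)) UNIV"
      unfolding B_def by (intro has_sum_add has_sum_cmult_right convolution_has_sum b e)
    have "cmod (complex_of_real (\<phi> k) * ell2_nth (L x) k - ell2_nth (L ?u) k) \<le> B k + g k * S"
    proof (rule norm_infsum_le[OF c d])
      show "cmod (?c l) \<le> ?d l" for l
        using comm[of k l] by (simp add: norm_mult of_real_diff[symmetric] del: of_real_diff)
    qed
    moreover have "cmod (complex_of_real (\<phi> k) * ell2_nth (L x) k) = \<bar>\<phi> k\<bar> * cmod (ell2_nth (L x) k)"
      by (simp add: norm_mult)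
    moreover have "cmod (ell2_nth (L ?u) k) \<le> cmod (complex_of_real (\<phi> k) * ell2_nth (L x) k)
        + cmod (complex_of_real (\<phi> k) * ell2_nth (L x) k - ell2_nth (L ?u) k)"
      by (metis norm_minus_commute norm_triangle_sub)
    ultimately show ?thesis using h[of k] by linarith
  qed
  moreover have "L2_set (\<lambda>k. B k + h k) F \<le> (\<Sum>\<^sub>\<infinity>j. b j) * norm f + H" if F: "finite F" for F
  proof -
    have "L2_set (\<lambda>k. B k + h k) F \<le> L2_set B F + L2_set h F"
      by (rule L2_set_triangle_ineq)
    also have "L2_set B F \<le> (\<Sum>\<^sub>\<infinity>j. b j) * norm f"
      unfolding B_def by (rule L2_set_convolution[OF b F])
    also have "L2_set h F \<le> H" by (rule H[OF F])
    finally show ?thesis by simp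
  qed
  ultimately have "norm (L ?u) \<le> (\<Sum>\<^sub>\<infinity>j. b j) * norm f + H"
    by (rule norm_ell2_le_L2_set)
  then show ?thesis using M(1)[of ?u] mult_left_mono[OF _ M(2)] by force
qed

section \<open>Finite sections and tails\<close>

lemma cinner_ell2_abs_summable: "(\<lambda>k. cmod (ell2_nth x k * cnj (ell2_nth y k))) summable_on UNIV"
proof (rule summable_on_comparison_test)
  show "(\<lambda>k. (cmod (ell2_nth x k))\<^sup>2 + (cmod (ell2_nth y k))\<^sup>2) summable_on UNIV"
    by (intro summable_on_add ell2_summable)
  show "cmod (ell2_nth x k * cnj (ell2_nth y k)) \<le> (cmod (ell2_nth x k))\<^sup>2 + (cmod (ell2_nth y k))\<^sup>2" for k
    using sum_squares_bound[of "cmod (ell2_nth x k)" "cmod (ell2_nth y k)"]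
      mult_nonneg_nonneg[OF norm_ge_zero norm_ge_zero, of "ell2_nth x k" "ell2_nth y k"]
    unfolding norm_mult complex_mod_cnj by linarith
qed simp

lemma cinner_ell2_has_sum:
  "((\<lambda>k. ell2_nth x k * cnj (ell2_nth y k)) has_sum cinner_ell2 x y) UNIV"
  unfolding cinner_ell2_def
  by (rule has_sum_infsum[OF abs_summable_summable[OF cinner_ell2_abs_summable]])

lemma cinner_ell2_diff_left: "cinner_ell2 (x - y) z = cinner_ell2 x z - cinner_ell2 y z"
proof (rule has_sum_unique[OF cinner_ell2_has_sum])
  have "((\<lambda>k. ell2_nth x k * cnj (ell2_nth z k) + - (ell2_nth y k * cnj (ell2_nth z k))) has_sum
      cinner_ell2 x z + - cinner_ell2 y z) UNIV"
    using cinner_ell2_has_sum[of y z]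
    by (intro has_sum_add cinner_ell2_has_sum) (simp add: has_sum_uminus)
  then show "((\<lambda>k. ell2_nth (x - y) k * cnj (ell2_nth z k)) has_sum
      cinner_ell2 x z - cinner_ell2 y z) UNIV"
    by (simp add: minus_ell2.rep_eq algebra_simps)
qed

lemma cinner_ell2_scaleR_left: "cinner_ell2 (r *\<^sub>R x) z = complex_of_real r * cinner_ell2 x z"
proof (rule has_sum_unique[OF cinner_ell2_has_sum])
  show "((\<lambda>k. ell2_nth (r *\<^sub>R x) k * cnj (ell2_nth z k)) has_sum
      complex_of_real r * cinner_ell2 x z) UNIV"
    using has_sum_cmult_right[OF cinner_ell2_has_sum[of x z], of "complex_of_real r"]
    by (simp add: scaleR_ell2.rep_eq scaleR_conv_of_real mult.assoc)
qed

lemma cinner_ell2_commute: "cinner_ell2 y x = cnj (cinner_ell2 x y)"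
  unfolding cinner_ell2_def infsum_cnj[symmetric] by (simp add: mult.commute)

lemma cinner_ell2_diff_right: "cinner_ell2 z (x - y) = cinner_ell2 z x - cinner_ell2 z y"
  using cinner_ell2_commute cinner_ell2_diff_left by (metis complex_cnj_diff)

lemma cinner_ell2_scaleR_right: "cinner_ell2 z (r *\<^sub>R x) = complex_of_real r * cinner_ell2 z x"
  using cinner_ell2_commute cinner_ell2_scaleR_left
  by (metis complex_cnj_mult complex_cnj_complex_of_real)

lemma norm_ell2_square: "(norm x)\<^sup>2 = (\<Sum>\<^sub>\<infinity>k. (cmod (ell2_nth x k))\<^sup>2)"
  unfolding norm_ell2_def by (intro real_sqrt_pow2 infsum_nonneg) simp

lemma cinner_ell2_self: "cinner_ell2 x x = complex_of_real ((norm x)\<^sup>2)"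
proof (rule has_sum_unique[OF cinner_ell2_has_sum])
  have "((\<lambda>k. (cmod (ell2_nth x k))\<^sup>2) has_sum (norm x)\<^sup>2) UNIV"
    unfolding norm_ell2_square by (rule has_sum_infsum[OF ell2_summable])
  from has_sum_of_real[OF this, where 'a = complex]
  show "((\<lambda>k. ell2_nth x k * cnj (ell2_nth x k)) has_sum complex_of_real ((norm x)\<^sup>2)) UNIV"
    by (simp only: complex_norm_square)
qed

lemma cinner_ell2_Cauchy_Schwarz: "cmod (cinner_ell2 x y) \<le> norm x * norm y"
proof -
  have "cmod (cinner_ell2 x y) \<le> (\<Sum>\<^sub>\<infinity>k. cmod (ell2_nth x k * cnj (ell2_nth y k)))"
    unfolding cinner_ell2_def by (rule norm_infsum_bound[OF cinner_ell2_abs_summable])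
  also have "\<dots> \<le> norm x * norm y"
  proof (rule infsum_le_finite_sums[OF cinner_ell2_abs_summable])
    fix F :: "int set" assume F: "finite F"
    have "(\<Sum>k\<in>F. cmod (ell2_nth x k * cnj (ell2_nth y k)))
        \<le> L2_set (\<lambda>k. cmod (ell2_nth x k)) F * L2_set (\<lambda>k. cmod (ell2_nth y k)) F"
      using L2_set_mult_ineq[of "\<lambda>k. cmod (ell2_nth x k)" "\<lambda>k. cmod (ell2_nth y k)" F]
      by (simp add: norm_mult)
    also have "\<dots> \<le> norm x * norm y"
      by (intro mult_mono L2_set_le_norm_ell2 F) auto
    finally show "(\<Sum>k\<in>F. cmod (ell2_nth x k * cnj (ell2_nth y k))) \<le> norm x * norm y" .
  qed
  finally show ?thesis .
qed

section \<open>Lower bounds from invertibility and positivity\<close>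

lemma hermitian_positive_definite_norm_le:
  assumes "hermitian_positive_definite L"
  shows "norm u \<le> onorm (inv_into UNIV L) * norm (L u)"
proof -
  have "bounded_linear (inv_into UNIV L)" "inv_into UNIV L (L u) = u"
    using assms unfolding hermitian_positive_definite_def by (auto simp: bij_def)
  then show ?thesis using onorm[of "inv_into UNIV L" "L u"] by simp
qed

text \<open>With M the norm of the inverse and \<open>L v = u\<close>, evaluate the nonnegative form
  of \<open>L\<close> at M u - v. Self-adjointness turns the cross terms into -2 M times the square
  of \<open>norm u\<close>, and the last term \<open>cinner_ell2 u v\<close> is at most M times that
  square. Cancelling one factor M gives the claim.\<close>

lemma hermitian_positive_definite_coercive:
  assumes L: "hermitian_positive_definite L" and lin: "bounded_linear L"
  shows "(norm u)\<^sup>2 \<le> onorm (inv_into UNIV L) * Re (cinner_ell2 (L u) u)"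
proof (cases "u = 0")
  case True
  then show ?thesis
    using linear_0[OF bounded_linear.linear[OF lin]] by (simp add: cinner_ell2_self)
next
  case False
  define M where "M = onorm (inv_into UNIV L)"
  define v where "v = inv_into UNIV L u"
  have sa: "\<And>x y. cinner_ell2 (L x) y = cinner_ell2 x (L y)"
    and pos: "\<And>x. 0 \<le> Re (cinner_ell2 (L x) x)"
    and Lv: "L v = u" and bl: "bounded_linear (inv_into UNIV L)"
    using L unfolding hermitian_positive_definite_def v_def by (auto simp: bij_is_surj surj_f_inv_f)
  have vu: "norm v \<le> M * norm u"
    unfolding M_def v_def by (rule onorm[OF bl])
  \<comment> \<open>M = 0 would force u = 0; positivity is what lets the factor M be cancelled at
    the end.\<close>
  have M: "0 < M"
    using hermitian_positive_definite_norm_le[OF L, of u] onorm_pos_le[OF bl] False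
    unfolding M_def by (cases "onorm (inv_into UNIV L) = 0") auto
  have Mv: "Re (cinner_ell2 u v) \<le> M * (norm u)\<^sup>2"
  proof -
    have "Re (cinner_ell2 u v) \<le> norm u * norm v"
      using cinner_ell2_Cauchy_Schwarz[of u v] complex_Re_le_cmod order_trans by blast
    also have "\<dots> \<le> norm u * (M * norm u)" by (intro mult_left_mono vu) simp
    finally show ?thesis by (simp add: power2_eq_square ac_simps)
  qed
  have Lw: "L (M *\<^sub>R u - v) = M *\<^sub>R L u - u"
    using lin Lv by (simp add: linear_diff linear_scale bounded_linear.linear)
  have "cinner_ell2 (L u) v = cinner_ell2 u u" using sa[of u v] Lv by simp
  then have "Re (cinner_ell2 (L (M *\<^sub>R u - v)) (M *\<^sub>R u - v))
      = M\<^sup>2 * Re (cinner_ell2 (L u) u) - 2 * M * (norm u)\<^sup>2 + Re (cinner_ell2 u v)"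
    unfolding Lw cinner_ell2_diff_left cinner_ell2_diff_right
      cinner_ell2_scaleR_left cinner_ell2_scaleR_right
    by (simp add: cinner_ell2_self power2_eq_square algebra_simps)
  then have "0 \<le> M * (M * Re (cinner_ell2 (L u) u) - (norm u)\<^sup>2)"
    using pos[of "M *\<^sub>R u - v"] Mv by (simp add: power2_eq_square algebra_simps)
  then show ?thesis
    using M unfolding M_def[symmetric] by (simp add: zero_le_mult_iff)
qed

section \<open>Finite sections as compressions of the operator\<close>

lemma extend_by_zero_outside: "int n \<le> \<bar>k\<bar> \<Longrightarrow> ell2_nth (extend_by_zero n v) k = 0"
  by (auto simp: extend_by_zero.rep_eq)

lemma extend_by_zero_nth:
  "i < 2 * n - 1 \<Longrightarrow> ell2_nth (extend_by_zero n v) (int i - int n + 1) = v $ i"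
  by (auto simp: extend_by_zero.rep_eq)

text \<open>This includes n = 0, where truncated subtraction makes \<open>2 * n - 1\<close> zero, in
  agreement with the empty window of integers.\<close>

lemma index_shift_cases:
  assumes "\<bar>k\<bar> < int n"
  obtains i where "i < 2 * n - 1" "k = int i - int n + 1"
  using assms by (intro that[of "nat (k + int n - 1)"]) auto

text \<open>\<open>section_matrix a n\<close> is the compression of \<open>L\<close> to the window:
  on a vector supported there, a row sum of \<open>L\<close> reduces to a finite sum, and row and
  column indices carry the same shift.\<close>

lemma toeplitz_extend_by_zero:
  assumes L: "toeplitz_operator a L" and v: "v \<in> carrier_vec (2 * n - 1)" and i: "i < 2 * n - 1"
  shows "ell2_nth (L (extend_by_zero n v)) (int i - int n + 1) = (section_matrix a n *\<^sub>v v) $ i"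
proof -
  let ?k = "int i - int n + 1" and ?g = "\<lambda>j. int j - int n + 1"
  let ?f = "\<lambda>l. a (?k - l) * ell2_nth (extend_by_zero n v) l"
  have "(?f has_sum sum ?f (?g ` {..<2 * n - 1})) UNIV"
  proof (rule iffD1[OF has_sum_cong_neutral has_sum_finite])
    fix l assume "l \<in> UNIV - ?g ` {..<2 * n - 1}"
    then have "\<not> \<bar>l\<bar> < int n"
      by (auto elim!: index_shift_cases)
    then show "?f l = 0" by (simp add: extend_by_zero_outside)
  qed auto
  then have "ell2_nth (L (extend_by_zero n v)) ?k = sum ?f (?g ` {..<2 * n - 1})"
    using toeplitz_sum[OF L] has_sum_unique by blast
  also have "\<dots> = (\<Sum>j<2 * n - 1. a (?k - ?g j) * v $ j)"
    by (subst sum.reindex) (auto simp: inj_on_def extend_by_zero_nth)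
  also have "\<dots> = (section_matrix a n *\<^sub>v v) $ i"
    using v i unfolding section_matrix_def
    by (simp add: scalar_prod_def atLeast0LessThan)
  finally show ?thesis .
qed

text \<open>A pairing with \<open>e\<close> sees only the support of \<open>e\<close>. This yields
  Galerkin orthogonality: an identity valid on the window suffices when tested against a vector
  supported in the window.\<close>

lemma cinner_ell2_eq_on_support:
  assumes "\<And>k. ell2_nth e k \<noteq> 0 \<Longrightarrow> ell2_nth u k = ell2_nth w k"
  shows "cinner_ell2 u e = cinner_ell2 w e"
  unfolding cinner_ell2_def using assms by (intro infsum_cong) force

text \<open>A nonzero kernel vector of the section matrix, extended by zero, would make the
  quadratic form of \<open>L\<close> vanish, which coercivity rules out. Hence \<open>the\<close> in
  \<open>section_solution\<close> returns a genuine inverse.\<close>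

lemma section_matrix_inverse:
  assumes L: "toeplitz_operator a L" "hermitian_positive_definite L"
  obtains B where "mat_inverse (section_matrix a n) = Some B"
    "section_matrix a n * B = 1\<^sub>m (2 * n - 1)" "B \<in> carrier_mat (2 * n - 1) (2 * n - 1)"
proof -
  let ?A = "section_matrix a n" and ?d = "2 * n - 1"
  have A: "?A \<in> carrier_mat ?d ?d" by (simp add: section_matrix_def)
  have lin: "bounded_linear L" using L(1) by (simp add: toeplitz_operator_def)
  have "det ?A \<noteq> 0"
  proof
    assume "det ?A = 0"
    then obtain v where v: "v \<in> carrier_vec ?d" "v \<noteq> 0\<^sub>v ?d" "?A *\<^sub>v v = 0\<^sub>v ?d"
      using det_0_iff_vec_prod_zero_field[OF A] by blast
    let ?e = "extend_by_zero n v"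
    have "cinner_ell2 (L ?e) ?e = cinner_ell2 0 ?e"
    proof (rule cinner_ell2_eq_on_support)
      fix k assume "ell2_nth ?e k \<noteq> 0"
      then have "\<bar>k\<bar> < int n" using extend_by_zero_outside[of n k v] by linarith
      then obtain i where "i < ?d" "k = int i - int n + 1" by (rule index_shift_cases)
      then show "ell2_nth (L ?e) k = ell2_nth 0 k"
        using toeplitz_extend_by_zero[OF L(1) v(1)] v(3) by (simp add: zero_ell2.rep_eq)
    qed
    also have "\<dots> = 0" by (simp add: cinner_ell2_def zero_ell2.rep_eq)
    finally have "?e = 0"
      using hermitian_positive_definite_coercive[OF L(2) lin, of ?e] by simp
    then have "v $ i = 0" if "i < ?d" for i
      using extend_by_zero_nth[OF that, of v] by (simp add: zero_ell2.rep_eq)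
    then have "v = 0\<^sub>v ?d" using v(1) by (intro eq_vecI) auto
    then show False using v(2) by contradiction
  qed
  then have "?A \<in> Units (ring_mat TYPE(complex) ?d ())"
    by (rule det_non_zero_imp_unit[OF A])
  then obtain B where "mat_inverse ?A = Some B"
    using mat_inverse(1)[OF A, of "()"] by (cases "mat_inverse ?A") auto
  then show thesis using that mat_inverse(2)[OF A] by blast
qed

lemma section_solution_outside:
  "int n \<le> \<bar>k\<bar> \<Longrightarrow> ell2_nth (section_solution a y n) k = 0"
  by (simp add: section_solution_def extend_by_zero_outside)

text \<open>The finite linear system carried over to \<open>ell2\<close>. Together with the support
  condition it is all that the error estimate uses about the approximate solution.\<close>

lemma toeplitz_section_solution:
  assumes L: "toeplitz_operator a L" "hermitian_positive_definite L" and k: "\<bar>k\<bar> < int n"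
  shows "ell2_nth (L (section_solution a y n)) k = ell2_nth y k"
proof -
  let ?A = "section_matrix a n" and ?d = "2 * n - 1"
  obtain B where B: "mat_inverse ?A = Some B" "?A * B = 1\<^sub>m ?d" "B \<in> carrier_mat ?d ?d"
    using section_matrix_inverse[OF L] .
  have A: "?A \<in> carrier_mat ?d ?d" by (simp add: section_matrix_def)
  have y: "section_vector y n \<in> carrier_vec ?d" by (simp add: section_vector_def)
  obtain i where i: "i < ?d" "k = int i - int n + 1" using index_shift_cases[OF k] .
  have "ell2_nth (L (section_solution a y n)) k = (?A *\<^sub>v (B *\<^sub>v section_vector y n)) $ i"
    unfolding section_solution_def B(1) i(2) option.sel
    by (rule toeplitz_extend_by_zero[OF L(1) mult_mat_vec_carrier[OF B(3) y] i(1)])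
  also have "?A *\<^sub>v (B *\<^sub>v section_vector y n) = section_vector y n"
    using assoc_mult_mat_vec[OF A B(3) y] y by (simp add: B(2))
  also have "section_vector y n $ i = ell2_nth y k"
    using i by (simp add: section_vector_def)
  finally show ?thesis .
qed

text \<open>Cea's argument: \<open>e\<close> compares the section solution with the truncation of
  \<open>x\<close>, so it is supported in the window, where \<open>L z\<close> and
  \<open>L x\<close> agree. Hence the form of \<open>L\<close> at \<open>e\<close> equals
  \<open>cinner_ell2 (L t) e\<close>, and coercivity bounds \<open>norm e\<close> by the condition
  number times \<open>norm t\<close>. The extra 1 accounts for \<open>t\<close> itself.\<close>

lemma section_error_le_tail:
  assumes L: "toeplitz_operator a L" "hermitian_positive_definite L"
  shows "norm (x - section_solution a (L x) n) \<le> (1 + condition_number L) * norm (ell2_tail n x)"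
proof -
  define z where "z = section_solution a (L x) n"
  define t where "t = ell2_tail n x"
  define e where "e = z - (x - t)"
  let ?M = "onorm (inv_into UNIV L)"
  have lin: "bounded_linear L" using L(1) by (simp add: toeplitz_operator_def)
  have M: "0 \<le> ?M"
    using L(2) unfolding hermitian_positive_definite_def by (auto intro: onorm_pos_le)
  have Le: "L e = L z - (L x - L t)"
    unfolding e_def using lin by (simp add: linear_diff bounded_linear.linear)
  have "cinner_ell2 (L e) e = cinner_ell2 (L t) e"
  proof (rule cinner_ell2_eq_on_support)
    fix k assume "ell2_nth e k \<noteq> 0"
    then have "\<bar>k\<bar> < int n"
      using section_solution_outside[of n k a "L x"]
      by (auto simp: e_def z_def t_def minus_ell2.rep_eq ell2_nth_tail split: if_splits)
    then show "ell2_nth (L e) k = ell2_nth (L t) k"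
      using toeplitz_section_solution[OF L, of k n "L x"]
      by (simp add: Le z_def minus_ell2.rep_eq)
  qed
  then have "Re (cinner_ell2 (L e) e) \<le> norm (L t) * norm e"
    using cinner_ell2_Cauchy_Schwarz[of "L t" e] complex_Re_le_cmod[of "cinner_ell2 (L t) e"]
    by simp
  also have "\<dots> \<le> (onorm L * norm t) * norm e"
    by (intro mult_right_mono onorm lin) simp
  finally have "?M * Re (cinner_ell2 (L e) e) \<le> ?M * ((onorm L * norm t) * norm e)"
    using M by (rule mult_left_mono)
  with hermitian_positive_definite_coercive[OF L(2) lin, of e]
  have "norm e * norm e \<le> (condition_number L * norm t) * norm e"
    by (simp add: condition_number_def power2_eq_square ac_simps)
  moreover have "0 \<le> condition_number L * norm t"
    unfolding condition_number_def by (intro mult_nonneg_nonneg M onorm_pos_le lin) auto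
  ultimately have "norm e \<le> condition_number L * norm t"
    by (cases "e = 0") auto
  moreover have "x - z = t - e" by (simp add: e_def)
  then have "norm (x - z) \<le> norm t + norm e" by (metis norm_triangle_ineq4)
  ultimately show ?thesis by (simp add: z_def t_def algebra_simps)
qed

section \<open>Exponential decay\<close>

text \<open>The weight exp(\<delta> |k|) is frozen from |k| = n on, so it is bounded and equals
  exp(\<delta> n) on the tail, while no constant depends on n. Fixing \<delta> and \<open>K\<close>
  before \<open>a\<close>, \<open>L\<close> and \<open>x\<close> makes the estimate uniform over all
  operators with the given bounds.\<close>

lemma exp_tail_decay:
  fixes \<gamma> c c' M :: real
  assumes \<gamma>: "0 < \<gamma>" and c: "0 \<le> c" and c': "0 \<le> c'" and M: "0 \<le> M"
  shows "\<exists>\<delta> K. 0 < \<delta> \<and> \<delta> < \<gamma> \<and> (\<forall>a L x. toeplitz_operator a L \<longrightarrow>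
    (\<forall>u. norm u \<le> M * norm (L u)) \<longrightarrow>
    (\<forall>k. cmod (a k) \<le> c * exp (- \<gamma> * real_of_int \<bar>k\<bar>)) \<longrightarrow>
    (\<forall>k. cmod (ell2_nth (L x) k) \<le> c' * exp (- \<gamma> * real_of_int \<bar>k\<bar>)) \<longrightarrow>
    (\<forall>n. norm (ell2_tail n x) \<le> K * exp (- \<delta> * real n)))"
proof -
  \<comment> \<open>Half of the rate \<gamma> pays for the growth of the weight and the other half
    stays in \<open>q\<close>; the linear factor comes from exp(t) - 1 \<le> t exp(t).\<close>
  define q where "q j = (1 + real_of_int \<bar>j\<bar>) * exp (- (\<gamma> / 2) * real_of_int \<bar>j\<bar>)" for j :: int
  define Y where "Y = (\<Sum>\<^sub>\<infinity>j. q j)"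
  have q0: "0 \<le> q j" for j by (simp add: q_def)
  have "summable (\<lambda>n. real (Suc n) * exp (- (\<gamma> / 2)) ^ n)"
    using geometric_deriv_sums[of "exp (- (\<gamma> / 2))"] \<gamma> by (simp add: sums_iff)
  from summable_on_nat_abs[OF this]
  have q: "q summable_on UNIV"
    unfolding q_def by (simp add: exp_of_nat2_mult[symmetric] algebra_simps)
  have Y0: "0 \<le> Y" unfolding Y_def by (intro infsum_nonneg q0)
  \<comment> \<open>The first bound keeps the weight below half of the decay of \<open>a\<close> and
    \<open>y\<close>, the second makes the commutator absorbable. The added 1 keeps the denominator
    positive.\<close>
  define \<delta> where "\<delta> = min (\<gamma> / 2) (1 / (2 * (M * c * Y + 1)))"
  have McY: "0 \<le> M * c * Y" using M c Y0 by simp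
  have \<delta>: "0 < \<delta>" "\<delta> \<le> \<gamma> / 2" unfolding \<delta>_def using \<gamma> McY by auto
  have "\<delta> * (2 * (M * c * Y + 1)) \<le> 1"
    using McY unfolding \<delta>_def by (subst pos_le_divide_eq[symmetric]) auto
  then have half: "M * (c * \<delta> * Y) \<le> 1 / 2" using \<delta>(1) by (simp add: algebra_simps)
  have main: "norm (ell2_tail n x) \<le> 2 * M * c' * Y * exp (- \<delta> * real n)"
    if L: "toeplitz_operator a L" and inv: "\<And>u. norm u \<le> M * norm (L u)"
      and a: "\<And>k. cmod (a k) \<le> c * exp (- \<gamma> * real_of_int \<bar>k\<bar>)"
      and y: "\<And>k. cmod (ell2_nth (L x) k) \<le> c' * exp (- \<gamma> * real_of_int \<bar>k\<bar>)"
    for a L x n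
  proof -
    define \<phi> where "\<phi> k = exp (\<delta> * real_of_int (min \<bar>k\<bar> (int n)))" for k :: int
    have \<phi>0: "0 \<le> \<phi> k" for k by (simp add: \<phi>_def)
    have \<phi>_bdd: "bounded (range \<phi>)"
      unfolding bounded_iff \<phi>_def using \<delta>(1)
      by (intro exI[of _ "exp (\<delta> * real n)"]) (auto intro!: mult_left_mono)
    let ?u = "ell2_mult \<phi> x"
    \<comment> \<open>The bound carries the weight at the column index \<open>l\<close>, so that the
      commutator is dominated by a convolution with \<phi> x itself.\<close>
    have lip: "\<bar>\<phi> k - \<phi> l\<bar> \<le> \<phi> l * (exp (\<delta> * \<bar>k - l\<bar>) - 1)" for k l
    proof -
      have step: "\<phi> i \<le> \<phi> j * exp (\<delta> * \<bar>k - l\<bar>)" if "\<bar>i - j\<bar> = \<bar>k - l\<bar>" for i j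
      proof -
        have "min \<bar>i\<bar> (int n) \<le> min \<bar>j\<bar> (int n) + \<bar>k - l\<bar>" using that by linarith
        then have "real_of_int (min \<bar>i\<bar> (int n)) \<le> real_of_int (min \<bar>j\<bar> (int n) + \<bar>k - l\<bar>)"
          by (rule of_int_le_iff[THEN iffD2])
        then have "\<delta> * real_of_int (min \<bar>i\<bar> (int n))
            \<le> \<delta> * (real_of_int (min \<bar>j\<bar> (int n)) + real_of_int \<bar>k - l\<bar>)"
          using \<delta>(1) by (intro mult_left_mono) simp_all
        then show ?thesis
          unfolding \<phi>_def by (simp add: exp_add[symmetric] distrib_left)
      qed
      have E: "0 \<le> exp (\<delta> * \<bar>k - l\<bar>) - 1" using \<delta>(1) by simp
      show ?thesis
      proof (cases "\<phi> l \<le> \<phi> k")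
        case True
        then show ?thesis using step[of k l] by (simp add: algebra_simps)
      next
        case False
        have "\<phi> l - \<phi> k \<le> \<phi> k * (exp (\<delta> * \<bar>k - l\<bar>) - 1)"
          using step[of l k] by (simp add: algebra_simps abs_minus_commute)
        also have "\<dots> \<le> \<phi> l * (exp (\<delta> * \<bar>k - l\<bar>) - 1)"
          using False E by (intro mult_right_mono) auto
        finally show ?thesis using False by simp
      qed
    qed
    have "norm ?u \<le> M * ((\<Sum>\<^sub>\<infinity>j. c * \<delta> * q j) * norm ?u + c' * Y)"
    proof (rule commutator_estimate[OF L inv M \<phi>_bdd, where e = "\<lambda>_. 0" and S = 0
          and g = "\<lambda>_. 0" and h = "\<lambda>k. c' * q k"])
      show "(\<lambda>j. c * \<delta> * q j) summable_on UNIV"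
        by (intro summable_on_cmult_right q)
      show "0 \<le> c * \<delta> * q j" for j using c \<delta> q0 by simp
      fix k l :: int
      let ?d = "real_of_int \<bar>k - l\<bar>"
      \<comment> \<open>This is 1 - t \<le> exp(-t) multiplied by exp(t).\<close>
      have "exp (\<delta> * ?d) - 1 \<le> \<delta> * ?d * exp (\<delta> * ?d)"
      proof -
        have "(1 + - (\<delta> * ?d)) * exp (\<delta> * ?d) \<le> exp (- (\<delta> * ?d)) * exp (\<delta> * ?d)"
          by (intro mult_right_mono exp_ge_add_one_self) simp
        then show ?thesis by (simp add: exp_minus algebra_simps)
      qed
      also have "\<dots> \<le> \<delta> * (1 + ?d) * exp (\<gamma> / 2 * ?d)"
        using \<delta> mult_right_mono[OF \<delta>(2), of ?d] by (intro mult_mono) auto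
      finally have e1: "exp (\<delta> * ?d) - 1 \<le> \<delta> * (1 + ?d) * exp (\<gamma> / 2 * ?d)" .
      have "cmod (a (k - l)) * \<bar>\<phi> k - \<phi> l\<bar>
          \<le> (c * exp (- \<gamma> * ?d)) * (\<phi> l * (\<delta> * (1 + ?d) * exp (\<gamma> / 2 * ?d)))"
        using lip[of k l] e1 \<phi>0[of l] c a[of "k - l"]
        by (intro mult_mono order_trans[OF lip] mult_left_mono e1) auto
      also have "\<dots> = c * \<delta> * q (k - l) * \<phi> l"
      proof -
        have e2: "exp (- \<gamma> * ?d) * exp (\<gamma> / 2 * ?d) = exp (- (\<gamma> / 2) * ?d)"
          by (simp add: exp_add[symmetric] field_simps)
        have "(c * exp (- \<gamma> * ?d)) * (\<phi> l * (\<delta> * (1 + ?d) * exp (\<gamma> / 2 * ?d)))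
            = c * \<delta> * ((1 + ?d) * (exp (- \<gamma> * ?d) * exp (\<gamma> / 2 * ?d))) * \<phi> l"
          by (simp only: ac_simps)
        then show ?thesis unfolding e2 q_def .
      qed
      finally have "cmod (a (k - l)) * \<bar>\<phi> k - \<phi> l\<bar> * cmod (ell2_nth x l)
          \<le> c * \<delta> * q (k - l) * \<phi> l * cmod (ell2_nth x l)"
        by (rule mult_right_mono) simp
      then show "cmod (a (k - l)) * \<bar>\<phi> k - \<phi> l\<bar> * cmod (ell2_nth x l)
          \<le> c * \<delta> * q (k - l) * cmod (ell2_nth ?u l) + 0 * 0"
        using \<phi>0[of l] by (simp add: ell2_nth_mult[OF \<phi>_bdd] norm_mult mult.assoc)
    next
      fix k :: int
      let ?d = "real_of_int \<bar>k\<bar>"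
      have "\<bar>\<phi> k\<bar> * cmod (ell2_nth (L x) k) \<le> exp (\<gamma> / 2 * ?d) * (c' * exp (- \<gamma> * ?d))"
      proof (intro mult_mono y)
        have "\<delta> * real_of_int (min \<bar>k\<bar> (int n)) \<le> \<gamma> / 2 * ?d"
          using \<gamma> \<delta> by (intro mult_mono) auto
        then show "\<bar>\<phi> k\<bar> \<le> exp (\<gamma> / 2 * ?d)" by (simp add: \<phi>_def)
      qed auto
      also have "\<dots> = c' * exp (- (\<gamma> / 2) * ?d)"
        by (simp add: mult.left_commute exp_add[symmetric] field_simps)
      also have "\<dots> \<le> c' * q k"
        unfolding q_def using c' by (intro mult_left_mono) (auto simp: mult_le_cancel_right1)
      finally show "\<bar>\<phi> k\<bar> * cmod (ell2_nth (L x) k) + 0 * 0 \<le> c' * q k" by simp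
    next
      fix F :: "int set" assume F: "finite F"
      have "L2_set (\<lambda>k. c' * q k) F \<le> (\<Sum>k\<in>F. c' * q k)"
        using c' q0 by (intro L2_set_le_sum) auto
      also have "\<dots> = c' * (\<Sum>k\<in>F. q k)" by (simp add: sum_distrib_left)
      also have "\<dots> \<le> c' * Y"
        unfolding Y_def using c' by (intro mult_left_mono finite_sum_le_infsum q F q0) auto
      finally show "L2_set (\<lambda>k. c' * q k) F \<le> c' * Y" .
    qed simp
    also have "\<dots> = M * (c * \<delta> * Y) * norm ?u + M * c' * Y"
      unfolding Y_def by (simp add: infsum_cmult_right' algebra_simps)
    \<comment> \<open>Absorption: \<phi> x belongs to \<open>ell2\<close>, so its norm is finite and
      half of it can be moved to the left-hand side.\<close>
    also have "\<dots> \<le> 1 / 2 * norm ?u + M * c' * Y"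
      by (intro add_right_mono mult_right_mono half) auto
    finally have u: "norm ?u \<le> 2 * M * c' * Y" by simp
    have "norm (exp (\<delta> * real n) *\<^sub>R ell2_tail n x) \<le> norm ?u"
    proof (rule norm_ell2_mono)
      show "cmod (ell2_nth (exp (\<delta> * real n) *\<^sub>R ell2_tail n x) k) \<le> cmod (ell2_nth ?u k)" for k
        by (auto simp: scaleR_ell2.rep_eq ell2_nth_tail ell2_nth_mult[OF \<phi>_bdd] norm_mult \<phi>_def)
    qed
    with u have "exp (\<delta> * real n) * norm (ell2_tail n x) \<le> 2 * M * c' * Y" by simp
    then show ?thesis by (simp add: exp_minus field_simps)
  qed
  have "\<delta> < \<gamma>" using \<delta>(2) \<gamma> by simp
  with \<delta>(1) main show ?thesis by blast
qed

section \<open>Polynomial decay\<close>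

text \<open>A telescoping form of the integral comparison. With \<open>w\<close> the left-hand side
  the claim reads \<open>w * (2 + x) \<le> x powr (1 - p)\<close>; after multiplication by
  \<open>x\<close> it follows from x (2 + x) \<le> (1 + x)^2 and the monotonicity of the power 2 - p
  \<le> 0.\<close>

lemma powr_tail_step:
  fixes p :: real
  assumes p: "2 \<le> p" and k: "1 \<le> k"
  shows "(1 + real k) powr - p \<le> real k powr (1 - p) - real (Suc k) powr (1 - p)"
proof -
  define x where "x = real k"
  have x: "1 \<le> x" using k by (simp add: x_def)
  define w where "w = (1 + x) powr - p"
  have w: "0 \<le> w" by (simp add: w_def)
  have e1: "(1 + x) powr (1 - p) = w * (1 + x)" and e2: "(1 + x) powr (2 - p) = w * (1 + x)\<^sup>2"
    unfolding w_def using x by (simp_all add: powr_diff powr_minus field_simps)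
  have "w * (1 + x)\<^sup>2 \<le> x powr (2 - p)"
    unfolding e2[symmetric] using x p by (intro powr_mono2') auto
  also have "x powr (2 - p) = x * x powr (1 - p)"
    using x powr_add[of x 1 "1 - p"] by simp
  finally have "w * (1 + x)\<^sup>2 \<le> x * x powr (1 - p)" .
  moreover have "x * (w * (2 + x)) \<le> w * (1 + x)\<^sup>2"
    using w by (simp add: power2_eq_square algebra_simps)
  ultimately have "x * (w * (2 + x)) \<le> x * x powr (1 - p)" by linarith
  then have "w * (2 + x) \<le> x powr (1 - p)" using x by simp
  then show ?thesis using e1 unfolding w_def x_def by (simp add: algebra_simps)
qed

lemma sum_powr_tail:
  fixes p :: real
  assumes "2 \<le> p" "1 \<le> N"
  shows "(\<Sum>k\<in>{N..<K}. (1 + real k) powr - p) \<le> real N powr (1 - p)"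
proof (cases "N \<le> K")
  case True
  have "(\<Sum>k\<in>{N..<K}. (1 + real k) powr - p)
      \<le> (\<Sum>k\<in>{N..<K}. real k powr (1 - p) - real (Suc k) powr (1 - p))"
    using assms by (intro sum_mono powr_tail_step) auto
  also have "\<dots> = real N powr (1 - p) - real K powr (1 - p)"
    using sum_Suc_diff'[OF True, of "\<lambda>k. - (real k powr (1 - p))"] by simp
  finally show ?thesis using powr_ge_zero[of "real K" "1 - p"] by linarith
qed simp

lemma L2_set_powr_tail:
  fixes s :: real
  assumes s: "1 \<le> s" and N: "1 \<le> N" and F: "finite F"
  shows "L2_set (\<lambda>k::int. if int N \<le> \<bar>k\<bar> then (1 + real_of_int \<bar>k\<bar>) powr - s else 0) F
    \<le> sqrt 2 * real N powr (1 / 2 - s)"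
proof -
  let ?w = "\<lambda>k::int. (1 + real_of_int \<bar>k\<bar>) powr - (2 * s)"
  have sq: "((1 + real_of_int \<bar>k\<bar>) powr - s)\<^sup>2 = ?w k" for k
    by (simp add: power2_eq_square powr_add[symmetric])
  obtain m where m: "\<And>k. k \<in> F \<Longrightarrow> \<bar>k\<bar> < int m"
  proof -
    have "\<exists>m::int. \<forall>k\<in>F. \<bar>k\<bar> < m"
      using F by (intro exI[of _ "Max (abs ` F) + 1"]) (auto intro: order_le_less_trans[OF Max_ge])
    then obtain m :: int where "\<forall>k\<in>F. \<bar>k\<bar> < m" ..
    then show thesis by (intro that[of "nat m"]) auto
  qed
  let ?A = "int ` {N..<m}" and ?B = "(\<lambda>k. - int k) ` {N..<m}"
  have sub: "{k\<in>F. int N \<le> \<bar>k\<bar>} \<subseteq> ?A \<union> ?B"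
  proof
    fix k assume "k \<in> {k\<in>F. int N \<le> \<bar>k\<bar>}"
    then have "nat \<bar>k\<bar> \<in> {N..<m}" using m[of k] by auto
    moreover have "k = int (nat \<bar>k\<bar>) \<or> k = - int (nat \<bar>k\<bar>)" by auto
    ultimately show "k \<in> ?A \<union> ?B" by blast
  qed
  have "(\<Sum>k\<in>F. (if int N \<le> \<bar>k\<bar> then (1 + real_of_int \<bar>k\<bar>) powr - s else 0)\<^sup>2)
      = (\<Sum>k\<in>{k\<in>F. int N \<le> \<bar>k\<bar>}. ?w k)"
    using F by (subst sum.inter_filter) (auto intro!: sum.cong simp: sq[unfolded of_int_abs])
  also have "\<dots> \<le> sum ?w (?A \<union> ?B)"
    by (intro sum_mono2 sub) auto
  \<comment> \<open>\<open>N \<ge> 1\<close> keeps 0 out of both images, so they are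
    disjoint.\<close>
  also have "\<dots> = sum ?w ?A + sum ?w ?B"
    using N by (intro sum.union_disjoint) auto
  also have "\<dots> = 2 * (\<Sum>k\<in>{N..<m}. (1 + real k) powr - (2 * s))"
    by (simp add: sum.reindex inj_on_def)
  also have "\<dots> \<le> 2 * real N powr (1 - 2 * s)"
    using sum_powr_tail[of "2 * s" N m] s N by simp
  finally have "L2_set (\<lambda>k::int. if int N \<le> \<bar>k\<bar> then (1 + real_of_int \<bar>k\<bar>) powr - s else 0) F
      \<le> sqrt (2 * real N powr (1 - 2 * s))"
    unfolding L2_set_def by (rule real_sqrt_le_mono)
  also have "\<dots> = sqrt 2 * real N powr (1 / 2 - s)"
    using N by (simp add: real_sqrt_mult powr_half_sqrt_powr[symmetric] field_simps)
  finally show ?thesis .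
qed

lemma summable_on_powr_int:
  assumes "1 < \<sigma>"
  shows "(\<lambda>k::int. (1 + real_of_int \<bar>k\<bar>) powr - \<sigma>) summable_on UNIV"
proof -
  have "summable (\<lambda>n. real (Suc n) powr - \<sigma>)"
    using assms by (subst summable_Suc_iff) (simp add: summable_real_powr_iff)
  from summable_on_nat_abs[OF this] show ?thesis by simp
qed

text \<open>The partial l1 norm of \<open>x\<close>. Membership in \<open>ell2\<close> gives no
  uniform bound for it, so its growth in \<open>N\<close> is tracked alongside the tails.\<close>

definition head_sum :: "nat \<Rightarrow> ell2 \<Rightarrow> real" where
  "head_sum N x = (\<Sum>l\<in>{- int N<..<int N}. cmod (ell2_nth x l))"

lemma head_sum_mono: "M \<le> N \<Longrightarrow> head_sum M x \<le> head_sum N x"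
  unfolding head_sum_def by (intro sum_mono2) auto

lemma head_sum_nonneg: "0 \<le> head_sum N x"
  unfolding head_sum_def by (intro sum_nonneg) auto

text \<open>Cauchy-Schwarz on the new indices; the full window has at most 8 N \<le> 9 N elements,
  whence the factor 3.\<close>

lemma head_sum_quadruple:
  "head_sum (4 * N) x \<le> head_sum N x + 3 * sqrt (real N) * norm (ell2_tail N x)"
proof -
  let ?F = "{- int (4 * N)<..<int (4 * N)}"
  have "head_sum (4 * N) x = (\<Sum>l\<in>?F. (if \<bar>l\<bar> < int N then cmod (ell2_nth x l) else 0)
      + cmod (ell2_nth (ell2_tail N x) l))"
    unfolding head_sum_def by (intro sum.cong) (auto simp: ell2_nth_tail)
  also have "\<dots> = (\<Sum>l\<in>?F. if \<bar>l\<bar> < int N then cmod (ell2_nth x l) else 0)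
      + (\<Sum>l\<in>?F. cmod (ell2_nth (ell2_tail N x) l))"
    by (rule sum.distrib)
  also have "(\<Sum>l\<in>?F. if \<bar>l\<bar> < int N then cmod (ell2_nth x l) else 0) = head_sum N x"
    unfolding head_sum_def by (rule sum.mono_neutral_cong_right) auto
  also have "(\<Sum>l\<in>?F. cmod (ell2_nth (ell2_tail N x) l))
      \<le> L2_set (\<lambda>_. 1) ?F * L2_set (\<lambda>l. cmod (ell2_nth (ell2_tail N x) l)) ?F"
    using L2_set_mult_ineq[of "\<lambda>_. 1" "\<lambda>l. cmod (ell2_nth (ell2_tail N x) l)" ?F] by simp
  also have "\<dots> \<le> (3 * sqrt (real N)) * norm (ell2_tail N x)"
  proof (intro mult_mono L2_set_le_norm_ell2)
    have "real (card ?F) \<le> 9 * real N" by simp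
    then have "sqrt (real (card ?F)) \<le> sqrt (9 * real N)" by (rule real_sqrt_le_mono)
    then show "L2_set (\<lambda>_. 1) ?F \<le> 3 * sqrt (real N)"
      by (simp add: L2_set_constant real_sqrt_mult)
  qed auto
  finally show ?thesis by simp
qed

text \<open>Interpolates between the trivial bound and the Lipschitz bound for a cutoff: only the
  power \<alpha> of the distance is spent, so the remaining decay of the matrix entries stays
  summable.\<close>

lemma min_1_le_powr:
  fixes u \<alpha> :: real
  assumes "0 < u" "0 \<le> \<alpha>" "\<alpha> \<le> 1"
  shows "min 1 u \<le> u powr \<alpha>"
proof (cases "1 \<le> u")
  case True
  then show ?thesis using ge_one_powr_ge_zero[OF True assms(2)] by simp
next
  case False
  then show ?thesis using powr_mono'[of \<alpha> 1 u] assms by simp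
qed

text \<open>A cutoff with slope \<open>1 / (2 * N)\<close> commutes with \<open>L\<close> up to a small multiple of the tail beyond
  \<open>N\<close>, apart from entries of \<open>a\<close> at distance at least \<open>\<bar>k\<bar> / 2\<close> from the diagonal.\<close>

lemma poly_tail_step:
  fixes s c c' M \<alpha> :: real
  assumes s: "1 < s" and c: "0 \<le> c" and c': "0 \<le> c'" and M: "0 \<le> M"
    and \<alpha>: "0 \<le> \<alpha>" "\<alpha> \<le> 1" "1 < s - \<alpha>"
    and L: "toeplitz_operator a L" and inv: "\<And>u. norm u \<le> M * norm (L u)"
    and a: "\<And>k. cmod (a k) \<le> c * (1 + real_of_int \<bar>k\<bar>) powr - s"
    and y: "\<And>k. cmod (ell2_nth (L x) k) \<le> c' * (1 + real_of_int \<bar>k\<bar>) powr - s"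
    and N: "1 \<le> N"
  shows "norm (ell2_tail (4 * N) x)
    \<le> M * c * (\<Sum>\<^sub>\<infinity>j::int. (1 + real_of_int \<bar>j\<bar>) powr - (s - \<alpha>)) * real N powr - \<alpha> * norm (ell2_tail N x)
      + M * (c' + c * 2 powr s) * sqrt 2 * real N powr (1 / 2 - s) * (1 + head_sum N x)"
proof -
  define \<phi> where "\<phi> k = min 1 (max 0 (real_of_int \<bar>k\<bar> / (2 * real N) - 1))" for k :: int
  define b where "b j = c * real N powr - \<alpha> * (1 + real_of_int \<bar>j\<bar>) powr - (s - \<alpha>)" for j :: int
  define w where "w k = (if int N \<le> \<bar>k\<bar> then (1 + real_of_int \<bar>k\<bar>) powr - s else 0)" for k :: int
  define S where "S = head_sum N x"
  let ?u = "ell2_mult \<phi> x" and ?t = "ell2_tail N x"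
  let ?Z = "\<Sum>\<^sub>\<infinity>j::int. (1 + real_of_int \<bar>j\<bar>) powr - (s - \<alpha>)"
  let ?e = "\<lambda>l. if \<bar>l\<bar> < int N then cmod (ell2_nth x l) else 0"
  have N0: "0 < real N" using N by simp
  have S0: "0 \<le> S" by (simp add: S_def head_sum_nonneg)
  have \<phi>01: "0 \<le> \<phi> k" "\<phi> k \<le> 1" for k by (auto simp: \<phi>_def)
  have \<phi>_bdd: "bounded (range \<phi>)"
    unfolding bounded_iff using \<phi>01 by (intro exI[of _ 1]) (simp add: \<phi>01)
  have \<phi>_near: "\<phi> k = 0" if "\<bar>k\<bar> \<le> 2 * int N" for k
  proof -
    have "real_of_int \<bar>k\<bar> \<le> real_of_int (2 * int N)" using that by (rule of_int_le_iff[THEN iffD2])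
    then show ?thesis using N0 by (simp add: \<phi>_def field_simps)
  qed
  have \<phi>_far: "\<phi> k = 1" if "4 * int N \<le> \<bar>k\<bar>" for k
  proof -
    have "real_of_int (4 * int N) \<le> real_of_int \<bar>k\<bar>" using that by (rule of_int_le_iff[THEN iffD2])
    then show ?thesis using N0 by (simp add: \<phi>_def field_simps)
  qed
  have lip: "\<bar>\<phi> k - \<phi> l\<bar> \<le> ((1 + real_of_int \<bar>k - l\<bar>) / real N) powr \<alpha>" for k l
  proof -
    have "\<bar>\<phi> k - \<phi> l\<bar> \<le> \<bar>real_of_int \<bar>k\<bar> / (2 * real N) - real_of_int \<bar>l\<bar> / (2 * real N)\<bar>"
      unfolding \<phi>_def by linarith
    also have "\<dots> = \<bar>real_of_int \<bar>k\<bar> - real_of_int \<bar>l\<bar>\<bar> / (2 * real N)"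
      using N0 by (simp add: diff_divide_distrib[symmetric] abs_divide)
    also have "\<dots> \<le> (1 + real_of_int \<bar>k - l\<bar>) / real N"
      using N0 by (intro frac_le) auto
    finally have "\<bar>\<phi> k - \<phi> l\<bar> \<le> min 1 ((1 + real_of_int \<bar>k - l\<bar>) / real N)"
      using \<phi>01[of k] \<phi>01[of l] by simp
    also have "\<dots> \<le> ((1 + real_of_int \<bar>k - l\<bar>) / real N) powr \<alpha>"
      using N0 \<alpha> by (intro min_1_le_powr) auto
    finally show ?thesis .
  qed
  have "norm ?u \<le> M * ((\<Sum>\<^sub>\<infinity>j. b j) * norm ?t + (c' + c * 2 powr s * S) * (sqrt 2 * real N powr (1 / 2 - s)))"
  proof (rule commutator_estimate[OF L inv M \<phi>_bdd, where e = ?e and S = S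
        and g = "\<lambda>k. c * 2 powr s * w k" and h = "\<lambda>k. (c' + c * 2 powr s * S) * w k"])
    show "b summable_on UNIV"
      unfolding b_def by (intro summable_on_cmult_right summable_on_powr_int \<alpha>)
    show "0 \<le> b j" for j using c by (simp add: b_def)
    have "(?e has_sum sum ?e {- int N<..<int N}) UNIV"
      by (rule iffD1[OF has_sum_cong_neutral has_sum_finite]) auto
    moreover have "sum ?e {- int N<..<int N} = S"
      unfolding S_def head_sum_def by (intro sum.cong) auto
    ultimately show "(?e has_sum S) UNIV" by simp
    fix k l :: int
    let ?d = "1 + real_of_int \<bar>k - l\<bar>"
    show "cmod (a (k - l)) * \<bar>\<phi> k - \<phi> l\<bar> * cmod (ell2_nth x l)
        \<le> b (k - l) * cmod (ell2_nth ?t l) + c * 2 powr s * w k * ?e l"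
    \<comment> \<open>Columns with |l| \<ge> N enter the convolution with the tail; the remaining
      columns enter the rank-one part, whose sum over \<open>l\<close> is the head sum.\<close>
    proof (cases "\<bar>l\<bar> < int N")
      case False
      have "cmod (a (k - l)) * \<bar>\<phi> k - \<phi> l\<bar> \<le> (c * ?d powr - s) * (?d / real N) powr \<alpha>"
        using c by (intro mult_mono a lip) auto
      also have "\<dots> = b (k - l)"
        unfolding b_def using N0 powr_add[of ?d "- s" \<alpha>]
        by (simp add: powr_divide powr_minus field_simps)
      finally have "cmod (a (k - l)) * \<bar>\<phi> k - \<phi> l\<bar> * cmod (ell2_nth x l) \<le> b (k - l) * cmod (ell2_nth x l)"
        by (rule mult_right_mono) simp
      then show ?thesis using False by (simp add: ell2_nth_tail)
    next
      case True
      have l: "\<phi> l = 0" using True by (intro \<phi>_near) simp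
      have "cmod (a (k - l)) * \<bar>\<phi> k - \<phi> l\<bar> \<le> c * 2 powr s * w k"
      proof (cases "\<bar>k\<bar> \<le> 2 * int N")
        case True
        then show ?thesis using l c \<phi>_near[of k] by (simp add: w_def)
      next
        case False
        \<comment> \<open>Since |k| > 2 N and |l| < N, the distance to the diagonal is comparable to
          |k|; the decay of \<open>a\<close> becomes decay in \<open>k\<close> alone at the price of
          \<open>2 powr s\<close>.\<close>
        have "\<bar>k\<bar> \<le> 2 * \<bar>k - l\<bar>" using False \<open>\<bar>l\<bar> < int N\<close> by (smt (verit))
        then have "real_of_int \<bar>k\<bar> \<le> real_of_int (2 * \<bar>k - l\<bar>)" by (rule of_int_le_iff[THEN iffD2])
        then have d: "(1 + real_of_int \<bar>k\<bar>) / 2 \<le> ?d" by simp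
        have "cmod (a (k - l)) * \<bar>\<phi> k - \<phi> l\<bar> \<le> cmod (a (k - l))"
          using l \<phi>01[of k] by (simp add: mult_left_le)
        also have "\<dots> \<le> c * ?d powr - s" by (rule a)
        also have "\<dots> \<le> c * ((1 + real_of_int \<bar>k\<bar>) / 2) powr - s"
          using c d s by (intro mult_left_mono powr_mono2') auto
        also have "\<dots> = c * 2 powr s * w k"
          using False by (simp add: w_def powr_divide powr_minus field_simps)
        finally show ?thesis .
      qed
      then have "cmod (a (k - l)) * \<bar>\<phi> k - \<phi> l\<bar> * cmod (ell2_nth x l)
          \<le> c * 2 powr s * w k * cmod (ell2_nth x l)"
        by (rule mult_right_mono) simp
      then show ?thesis using True by (simp add: ell2_nth_tail)
    qed
  next
    fix k :: int
    have "\<bar>\<phi> k\<bar> * cmod (ell2_nth (L x) k) \<le> c' * w k"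
    proof (cases "\<bar>k\<bar> \<le> 2 * int N")
      case True
      then show ?thesis using \<phi>_near[of k] c' by (simp add: w_def)
    next
      case False
      have "\<bar>\<phi> k\<bar> * cmod (ell2_nth (L x) k) \<le> 1 * (c' * (1 + real_of_int \<bar>k\<bar>) powr - s)"
        using \<phi>01[of k] by (intro mult_mono y) auto
      then show ?thesis using False by (simp add: w_def)
    qed
    then show "\<bar>\<phi> k\<bar> * cmod (ell2_nth (L x) k) + c * 2 powr s * w k * S \<le> (c' + c * 2 powr s * S) * w k"
      by (simp add: algebra_simps)
  next
    fix F :: "int set" assume F: "finite F"
    have nn: "0 \<le> c' + c * 2 powr s * S" using c c' S0 by simp
    have "L2_set (\<lambda>k. (c' + c * 2 powr s * S) * w k) F = (c' + c * 2 powr s * S) * L2_set w F"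
      by (simp add: L2_set_right_distrib[OF nn])
    also have "\<dots> \<le> (c' + c * 2 powr s * S) * (sqrt 2 * real N powr (1 / 2 - s))"
      unfolding w_def using s N F by (intro mult_left_mono nn L2_set_powr_tail) auto
    finally show "L2_set (\<lambda>k. (c' + c * 2 powr s * S) * w k) F
        \<le> (c' + c * 2 powr s * S) * (sqrt 2 * real N powr (1 / 2 - s))" .
  qed
  also have "(\<Sum>\<^sub>\<infinity>j. b j) = c * real N powr - \<alpha> * ?Z"
    unfolding b_def by (rule infsum_cmult_right')
  \<comment> \<open>The data term and the head term are merged into one multiple of 1 + S, the form
    required by the coupled recursion.\<close>
  also have "M * (c * real N powr - \<alpha> * ?Z * norm ?t + (c' + c * 2 powr s * S) * (sqrt 2 * real N powr (1 / 2 - s)))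
      \<le> M * (c * real N powr - \<alpha> * ?Z * norm ?t
        + ((c' + c * 2 powr s) * (1 + S)) * (sqrt 2 * real N powr (1 / 2 - s)))"
    using M c c' S0
    by (intro mult_left_mono add_left_mono mult_right_mono) (auto simp: algebra_simps)
  finally have "norm ?u \<le> M * c * ?Z * real N powr - \<alpha> * norm ?t
      + M * (c' + c * 2 powr s) * sqrt 2 * real N powr (1 / 2 - s) * (1 + S)"
    by (simp add: algebra_simps)
  moreover have "norm (ell2_tail (4 * N) x) \<le> norm ?u"
    using \<phi>_far by (intro norm_ell2_mono) (simp add: ell2_nth_tail ell2_nth_mult[OF \<phi>_bdd])
  ultimately show ?thesis unfolding S_def by linarith
qed

section \<open>Two real recursions\<close>

lemma bounded_of_contracting_recursion:
  fixes A :: "nat \<Rightarrow> real"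
  assumes rec: "\<And>j. A (Suc j) = e j * A j + D" and e: "e \<longlonglongrightarrow> 0"
    and nonneg: "\<And>j. 0 \<le> A j"
  shows "\<exists>B. \<forall>j. A j \<le> B"
proof -
  obtain J where J: "\<And>j. J \<le> j \<Longrightarrow> e j < 1 / 2"
    using order_tendstoD(2)[OF e, of "1 / 2"] by (auto simp: eventually_sequentially)
  \<comment> \<open>Once the factor is below 1/2, any bound of at least 2 D is preserved by A
    \<mapsto> A / 2 + D; the maximum covers the indices up to \<open>J\<close>.\<close>
  define B where "B = max (2 * D) (Max (A ` {..J}))"
  have le: "A j \<le> B" if "j \<le> J" for j
    using that unfolding B_def by (intro max.coboundedI2 Max_ge) auto
  have "A j \<le> B" if "J \<le> j" for j
    using that
  proof (induction j rule: dec_induct)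
    case (step j)
    have "e j * A j \<le> 1 / 2 * A j"
      using J[OF step.hyps(1)] nonneg[of j] by (intro mult_right_mono) auto
    moreover have "2 * D \<le> B" by (simp add: B_def)
    ultimately show ?case using rec[of j] step.IH by linarith
  qed (rule le, simp)
  with le show ?thesis by (meson nle_le)
qed

text \<open>The ratio of \<open>t j / p ^ j\<close> to \<open>1 + \<sigma> j\<close> obeys a contracting recursion, so \<open>1 + \<sigma> j\<close> grows at
  most by factors \<open>1 + const * (2 * p) ^ j\<close>, whose product converges because \<open>2 * p < 1\<close>.\<close>

lemma coupled_recursion_bound:
  fixes E D X p \<rho> :: real
  assumes E: "0 \<le> E" and D: "0 \<le> D" and X: "0 \<le> X" and p: "0 < p" "p < 1 / 2"
    and \<rho>: "0 \<le> \<rho>" "\<rho> < 1"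
  shows "\<exists>K. \<forall>t \<sigma>. t 0 \<le> X \<longrightarrow> \<sigma> 0 \<le> X \<longrightarrow> (\<forall>j. 0 \<le> t j) \<longrightarrow> (\<forall>j. 0 \<le> \<sigma> j) \<longrightarrow>
    (\<forall>j. t (Suc j) \<le> E * \<rho> ^ j * t j + D * p ^ j * (1 + \<sigma> j)) \<longrightarrow>
    (\<forall>j. \<sigma> j \<le> \<sigma> (Suc j)) \<longrightarrow> (\<forall>j. \<sigma> (Suc j) \<le> \<sigma> j + 3 * 2 ^ j * t j) \<longrightarrow>
    (\<forall>j. t j \<le> K * p ^ j)"
proof -
  \<comment> \<open>\<open>A j\<close> majorises \<open>t j / (p ^ j * (1 + \<sigma> j))\<close>;
    dividing by \<open>p ^ Suc j\<close> produces the factors E / p and D / p. It is built without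
    \<open>t\<close> and \<sigma>, so the final constant is uniform in them.\<close>
  define A where "A = rec_nat X (\<lambda>j r. E / p * \<rho> ^ j * r + D / p)"
  have A_0: "A 0 = X" and A_Suc: "A (Suc j) = E / p * \<rho> ^ j * A j + D / p" for j
    by (simp_all add: A_def)
  have A0: "0 \<le> A j" for j
    by (induction j) (use E D X p \<rho> in \<open>auto simp: A_0 A_Suc\<close>)
  have "(\<lambda>j. E / p * \<rho> ^ j) \<longlonglongrightarrow> E / p * 0"
    using \<rho> by (intro tendsto_intros LIMSEQ_realpow_zero)
  then obtain B where B: "\<And>j. A j \<le> B"
    using bounded_of_contracting_recursion[of A "\<lambda>j. E / p * \<rho> ^ j" "D / p"] A_Suc A0 by auto
  have B0: "0 \<le> B" using A0[of 0] B[of 0] by linarith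
  define G where "G = (1 + X) * exp (3 * B / (1 - 2 * p))"
  have "t j \<le> B * G * p ^ j"
    if init: "t 0 \<le> X" "\<sigma> 0 \<le> X" and t0: "\<And>j. 0 \<le> t j" and \<sigma>0: "\<And>j. 0 \<le> \<sigma> j"
      and t: "\<And>j. t (Suc j) \<le> E * \<rho> ^ j * t j + D * p ^ j * (1 + \<sigma> j)"
      and mono: "\<And>j. \<sigma> j \<le> \<sigma> (Suc j)" and \<sigma>: "\<And>j. \<sigma> (Suc j) \<le> \<sigma> j + 3 * 2 ^ j * t j"
    for t \<sigma> :: "nat \<Rightarrow> real" and j
  proof -
    have ratio: "t j \<le> A j * (1 + \<sigma> j) * p ^ j" for j
    proof (induction j)
      case 0
      have "X * 1 \<le> X * (1 + \<sigma> 0)" using X \<sigma>0[of 0] by (intro mult_left_mono) auto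
      then show ?case using init by (simp add: A_0)
    next
      case (Suc j)
      have "t (Suc j) \<le> E * \<rho> ^ j * (A j * (1 + \<sigma> j) * p ^ j) + D * p ^ j * (1 + \<sigma> j)"
        using E \<rho> Suc.IH by (intro order_trans[OF t] add_right_mono mult_left_mono) auto
      also have "\<dots> = A (Suc j) * (1 + \<sigma> j) * p ^ Suc j"
        using p by (simp add: A_Suc field_simps)
      also have "\<dots> \<le> A (Suc j) * (1 + \<sigma> (Suc j)) * p ^ Suc j"
        using p A0[of "Suc j"] mono[of j] by (intro mult_right_mono mult_left_mono) auto
      finally show ?case .
    qed
    have ratio': "t j \<le> B * (1 + \<sigma> j) * p ^ j" for j
    proof -
      have "A j * (1 + \<sigma> j) * p ^ j \<le> B * (1 + \<sigma> j) * p ^ j"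
        using B[of j] \<sigma>0[of j] p by (intro mult_right_mono) auto
      with ratio[of j] show ?thesis by linarith
    qed
    have growth: "1 + \<sigma> j \<le> (1 + X) * exp (3 * B * (\<Sum>i<j. (2 * p) ^ i))" for j
    proof (induction j)
      case 0
      then show ?case using init by simp
    next
      case (Suc j)
      have "1 + \<sigma> (Suc j) \<le> 1 + \<sigma> j + 3 * 2 ^ j * t j" using \<sigma>[of j] by linarith
      also have "\<dots> \<le> 1 + \<sigma> j + 3 * 2 ^ j * (B * (1 + \<sigma> j) * p ^ j)"
        using ratio'[of j] by (intro add_left_mono mult_left_mono) auto
      also have "\<dots> = (1 + \<sigma> j) * (1 + 3 * B * (2 * p) ^ j)"
        by (simp add: power_mult_distrib algebra_simps)
      \<comment> \<open>The product of the growth factors becomes the exponential of a geometric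
        sum.\<close>
      also have "\<dots> \<le> (1 + \<sigma> j) * exp (3 * B * (2 * p) ^ j)"
        using \<sigma>0[of j] by (intro mult_left_mono exp_ge_add_one_self) auto
      also have "\<dots> \<le> ((1 + X) * exp (3 * B * (\<Sum>i<j. (2 * p) ^ i))) * exp (3 * B * (2 * p) ^ j)"
        by (intro mult_right_mono Suc.IH) simp
      also have "\<dots> = (1 + X) * exp (3 * B * (\<Sum>i<Suc j. (2 * p) ^ i))"
        by (simp add: exp_add distrib_left)
      finally show ?case .
    qed
    have "(\<Sum>i<j. (2 * p) ^ i) \<le> 1 / (1 - 2 * p)"
    proof -
      have "(\<Sum>i<j. (2 * p) ^ i) \<le> (\<Sum>i. (2 * p) ^ i)"
        using p by (intro sum_le_suminf summable_geometric) auto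
      also have "\<dots> = 1 / (1 - 2 * p)" using p by (intro suminf_geometric) auto
      finally show ?thesis .
    qed
    then have "3 * B * (\<Sum>i<j. (2 * p) ^ i) \<le> 3 * B / (1 - 2 * p)"
      using B0 mult_left_mono[of "\<Sum>i<j. (2 * p) ^ i" "1 / (1 - 2 * p)" "3 * B"] by simp
    then have "1 + \<sigma> j \<le> G"
      unfolding G_def using X by (intro order_trans[OF growth] mult_left_mono) auto
    then have "B * (1 + \<sigma> j) * p ^ j \<le> B * G * p ^ j"
      using B0 p by (intro mult_right_mono mult_left_mono) auto
    with ratio'[of j] show ?thesis by linarith
  qed
  then show ?thesis by (intro exI[of _ "B * G"]) blast
qed

lemma poly_tail_decay:
  fixes s c c' M :: real
  assumes s: "1 < s" and c: "0 \<le> c" and c': "0 \<le> c'" and M: "0 \<le> M"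
  shows "\<exists>K. \<forall>a L x. toeplitz_operator a L \<longrightarrow>
    (\<forall>u. norm u \<le> M * norm (L u)) \<longrightarrow>
    (\<forall>k. cmod (a k) \<le> c * (1 + real_of_int \<bar>k\<bar>) powr - s) \<longrightarrow>
    (\<forall>k. cmod (ell2_nth (L x) k) \<le> c' * (1 + real_of_int \<bar>k\<bar>) powr - s) \<longrightarrow>
    (\<forall>n\<ge>1. norm (ell2_tail n x) \<le> K * real n powr (1 / 2 - s))"
proof -
  \<comment> \<open>Any positive \<alpha> below s - 1 leaves a summable exponent s - \<alpha>; the
    minimum with 1 meets the range needed for interpolation.\<close>
  define \<alpha> where "\<alpha> = min 1 ((s - 1) / 2)"
  have \<alpha>: "0 < \<alpha>" "\<alpha> \<le> 1" "1 < s - \<alpha>" using s by (auto simp: \<alpha>_def min_def field_simps)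
  \<comment> \<open>The target rate at N = 4^j. The condition p < 1/2 of the recursion is equivalent
    to s > 1.\<close>
  define p where "p = (4::real) powr (1 / 2 - s)"
  define \<rho> where "\<rho> = (4::real) powr - \<alpha>"
  define w where "w k = (1 + real_of_int \<bar>k\<bar>) powr - s" for k :: int
  define W where "W = (\<Sum>\<^sub>\<infinity>k. w k)"
  \<comment> \<open>An a priori bound for \<open>norm x\<close>, from the l1 bound on the data and
    the lower bound of \<open>L\<close>; it starts both recursions at N = 1.\<close>
  define X where "X = M * (c' * W)"
  define E where "E = M * c * (\<Sum>\<^sub>\<infinity>j::int. (1 + real_of_int \<bar>j\<bar>) powr - (s - \<alpha>))"
  define D where "D = M * (c' + c * 2 powr s) * sqrt 2"
  have w: "w summable_on UNIV" unfolding w_def by (rule summable_on_powr_int[OF s])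
  have X: "0 \<le> X" unfolding X_def W_def w_def using M c' by (simp add: infsum_nonneg)
  have E: "0 \<le> E" unfolding E_def using M c by (simp add: infsum_nonneg)
  have D: "0 \<le> D" unfolding D_def using M c c' by simp
  have p0: "0 < p" by (simp add: p_def)
  have "p < (4::real) powr (- 1 / 2)"
    unfolding p_def using s by (intro powr_less_mono) auto
  also have "\<dots> = 1 / 2" by (simp add: powr_minus_divide powr_half_sqrt)
  finally have p1: "p < 1 / 2" .
  have "\<rho> < (4::real) powr 0"
    unfolding \<rho>_def using \<alpha> by (intro powr_less_mono) auto
  then have \<rho>: "0 \<le> \<rho>" "\<rho> < 1" by (simp_all add: \<rho>_def)
  have pow4: "real (4 ^ j) powr r = (4 powr r) ^ j" for j r
    by (simp add: powr_realpow[symmetric] powr_powr mult.commute)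
  obtain K where K: "\<And>t \<sigma> j. t 0 \<le> X \<Longrightarrow> \<sigma> 0 \<le> X \<Longrightarrow> (\<And>j. 0 \<le> t j) \<Longrightarrow> (\<And>j. 0 \<le> \<sigma> j) \<Longrightarrow>
      (\<And>j. t (Suc j) \<le> E * \<rho> ^ j * t j + D * p ^ j * (1 + \<sigma> j)) \<Longrightarrow>
      (\<And>j. \<sigma> j \<le> \<sigma> (Suc j)) \<Longrightarrow> (\<And>j. \<sigma> (Suc j) \<le> \<sigma> j + 3 * 2 ^ j * t j) \<Longrightarrow> t j \<le> K * p ^ j"
    using coupled_recursion_bound[OF E D X p0 p1 \<rho>] by blast
  have "norm (ell2_tail n x) \<le> K * 4 powr (s - 1 / 2) * real n powr (1 / 2 - s)"
    if L: "toeplitz_operator a L" and inv: "\<And>u. norm u \<le> M * norm (L u)"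
      and a: "\<And>k. cmod (a k) \<le> c * (1 + real_of_int \<bar>k\<bar>) powr - s"
      and y: "\<And>k. cmod (ell2_nth (L x) k) \<le> c' * (1 + real_of_int \<bar>k\<bar>) powr - s"
      and n: "1 \<le> n"
    for a L x n
  proof -
    have "norm (L x) \<le> c' * W"
    proof (rule norm_ell2_le_L2_set)
      show "cmod (ell2_nth (L x) k) \<le> c' * w k" for k using y by (simp add: w_def)
      fix F :: "int set" assume F: "finite F"
      have "L2_set (\<lambda>k. c' * w k) F \<le> (\<Sum>k\<in>F. c' * w k)"
        using c' by (intro L2_set_le_sum) (auto simp: w_def)
      also have "\<dots> = c' * (\<Sum>k\<in>F. w k)" by (simp add: sum_distrib_left)
      also have "\<dots> \<le> c' * W"
        unfolding W_def using c' by (intro mult_left_mono finite_sum_le_infsum w F) (auto simp: w_def)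
      finally show "L2_set (\<lambda>k. c' * w k) F \<le> c' * W" .
    qed
    then have x: "norm x \<le> X"
      unfolding X_def using mult_left_mono[OF _ M] inv[of x] by (metis order_trans)
    have dyadic: "norm (ell2_tail (4 ^ j) x) \<le> K * p ^ j" for j
    proof (rule K[where \<sigma> = "\<lambda>j. head_sum (4 ^ j) x"])
      show "norm (ell2_tail (4 ^ 0) x) \<le> X"
        using x norm_ell2_tail_le order_trans by blast
      have "{- 1<..<1::int} = {0}" by auto
      then show "head_sum (4 ^ 0) x \<le> X"
        using ell2_nth_le_norm[of x 0] x by (simp add: head_sum_def)
      show "norm (ell2_tail (4 ^ Suc j) x) \<le> E * \<rho> ^ j * norm (ell2_tail (4 ^ j) x)
          + D * p ^ j * (1 + head_sum (4 ^ j) x)" for j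
        using poly_tail_step[OF s c c' M less_imp_le[OF \<alpha>(1)] \<alpha>(2,3) L inv a y, of "4 ^ j"]
        unfolding E_def D_def \<rho>_def p_def pow4[symmetric] by simp
      show "head_sum (4 ^ j) x \<le> head_sum (4 ^ Suc j) x" for j
        by (rule head_sum_mono) simp
      have "sqrt (real (4 ^ j)) = 2 ^ j" for j
        by (simp add: real_sqrt_power)
      then show "head_sum (4 ^ Suc j) x \<le> head_sum (4 ^ j) x + 3 * 2 ^ j * norm (ell2_tail (4 ^ j) x)" for j
        using head_sum_quadruple[of "4 ^ j" x] by simp
    qed (auto simp: head_sum_nonneg)
    obtain j where j: "4 ^ j \<le> n" "n < 4 ^ Suc j"
      using ex_power_ivl1[of 4 n] n by auto
    have K0: "0 \<le> K" using order_trans[OF norm_ge_zero dyadic[of 0]] by simp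
    have "norm (ell2_tail n x) \<le> K * p ^ j"
      using norm_ell2_tail_antimono[OF j(1)] dyadic order_trans by blast
    \<comment> \<open>Passing from \<open>4 ^ j\<close> to \<open>4 ^ Suc j\<close>, which exceeds
      \<open>n\<close>, costs the factor \<open>4 powr (s - 1 / 2)\<close>.\<close>
    also have "p ^ j = 4 powr (s - 1 / 2) * real (4 ^ Suc j) powr (1 / 2 - s)"
      unfolding pow4 p_def by (simp add: powr_add[symmetric])
    also have "K * \<dots> \<le> K * (4 powr (s - 1 / 2) * real n powr (1 / 2 - s))"
      using K0 n s j(2) by (intro mult_left_mono powr_mono2') (auto simp del: power_Suc)
    finally show ?thesis by (simp add: mult.assoc)
  qed
  then show ?thesis by blast
qed

section \<open>Error bounds\<close>

text \<open>The norm of the inverse is recovered as a quotient of the condition number and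
  \<open>onorm L\<close>, so constants can be fixed from these numbers before \<open>L\<close> is
  given. If \<open>onorm L = 0\<close>, division yields 0, and the bound holds because
  \<open>L u = 0\<close> forces u = 0.\<close>

lemma hermitian_positive_definite_norm_le_condition:
  assumes L: "toeplitz_operator a L" "hermitian_positive_definite L"
  shows "norm u \<le> \<bar>condition_number L / onorm L\<bar> * norm (L u)"
proof (cases "onorm L = 0")
  case True
  then have "norm (L u) \<le> 0"
    using onorm[of L u] L(1) by (simp add: toeplitz_operator_def)
  then show ?thesis using hermitian_positive_definite_norm_le[OF L(2), of u] by simp
next
  case False
  have "0 \<le> onorm (inv_into UNIV L)"
    using L(2) unfolding hermitian_positive_definite_def by (auto intro: onorm_pos_le)
  with False have "\<bar>condition_number L / onorm L\<bar> = onorm (inv_into UNIV L)"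
    by (simp add: condition_number_def)
  then show ?thesis using hermitian_positive_definite_norm_le[OF L(2)] by simp
qed

lemma condition_number_nonneg:
  assumes "toeplitz_operator a L" "hermitian_positive_definite L"
  shows "0 \<le> condition_number L"
  using assms unfolding condition_number_def toeplitz_operator_def hermitian_positive_definite_def
  by (auto intro!: mult_nonneg_nonneg onorm_pos_le)

lemma exp_section_error:
  fixes \<gamma> c c' \<nu> \<kappa> :: real
  assumes \<gamma>: "0 < \<gamma>"
  shows "\<exists>\<gamma>\<^sub>1. 0 < \<gamma>\<^sub>1 \<and> \<gamma>\<^sub>1 < \<gamma> \<and> (\<forall>a L x y. toeplitz_operator a L \<longrightarrow>
    hermitian_positive_definite L \<longrightarrow> L x = y \<longrightarrow> onorm L = \<nu> \<longrightarrow> condition_number L = \<kappa> \<longrightarrow>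
    (\<forall>k. cmod (a k) \<le> c * exp (- \<gamma> * real_of_int \<bar>k\<bar>)) \<longrightarrow>
    (\<forall>k. cmod (ell2_nth y k) \<le> c' * exp (- \<gamma> * real_of_int \<bar>k\<bar>)) \<longrightarrow>
    (\<forall>n\<ge>1. norm (x - section_solution a y n) \<le> 1 / \<gamma>\<^sub>1 * exp (- \<gamma>\<^sub>1 * real n)))"
proof -
  obtain \<delta> K where \<delta>: "0 < \<delta>" "\<delta> < \<gamma>" and K: "\<And>a L x n. toeplitz_operator a L \<Longrightarrow>
    (\<And>u. norm u \<le> \<bar>\<kappa> / \<nu>\<bar> * norm (L u)) \<Longrightarrow>
    (\<And>k. cmod (a k) \<le> \<bar>c\<bar> * exp (- \<gamma> * real_of_int \<bar>k\<bar>)) \<Longrightarrow>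
    (\<And>k. cmod (ell2_nth (L x) k) \<le> \<bar>c'\<bar> * exp (- \<gamma> * real_of_int \<bar>k\<bar>)) \<Longrightarrow>
    norm (ell2_tail n x) \<le> K * exp (- \<delta> * real n)"
    using exp_tail_decay[OF \<gamma> abs_ge_zero[of c] abs_ge_zero[of c'] abs_ge_zero[of "\<kappa> / \<nu>"]] by blast
  \<comment> \<open>\<open>R\<close> dominates the true constant and is positive. Taking the new
    rate at most 1 / R makes its reciprocal at least \<open>R\<close>, while a rate below \<delta>
    only weakens the exponential.\<close>
  define R where "R = \<bar>(1 + \<kappa>) * K\<bar> + 1"
  define \<gamma>\<^sub>1 where "\<gamma>\<^sub>1 = min \<delta> (1 / R)"
  have R: "0 < R" by (simp add: R_def add_nonneg_pos)
  have \<gamma>\<^sub>1: "0 < \<gamma>\<^sub>1" "\<gamma>\<^sub>1 \<le> \<delta>" using R \<delta> by (auto simp: \<gamma>\<^sub>1_def)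
  have "R * \<gamma>\<^sub>1 \<le> R * (1 / R)" using R by (intro mult_left_mono) (auto simp: \<gamma>\<^sub>1_def)
  then have R\<gamma>: "R \<le> 1 / \<gamma>\<^sub>1" using R \<gamma>\<^sub>1 by (simp add: field_simps)
  have main: "norm (x - section_solution a (L x) n) \<le> 1 / \<gamma>\<^sub>1 * exp (- \<gamma>\<^sub>1 * real n)"
    if L: "toeplitz_operator a L" "hermitian_positive_definite L"
      and \<nu>: "onorm L = \<nu>" and \<kappa>: "condition_number L = \<kappa>"
      and a: "\<And>k. cmod (a k) \<le> c * exp (- \<gamma> * real_of_int \<bar>k\<bar>)"
      and y: "\<And>k. cmod (ell2_nth (L x) k) \<le> c' * exp (- \<gamma> * real_of_int \<bar>k\<bar>)"
    for a L x n
  proof -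
    have "norm (ell2_tail n x) \<le> K * exp (- \<delta> * real n)"
    proof (rule K[OF L(1)])
      show "norm u \<le> \<bar>\<kappa> / \<nu>\<bar> * norm (L u)" for u
        using hermitian_positive_definite_norm_le_condition[OF L, of u] by (simp add: \<nu> \<kappa>)
      show "cmod (a k) \<le> \<bar>c\<bar> * exp (- \<gamma> * real_of_int \<bar>k\<bar>)" for k
        by (rule order_trans[OF a]) (intro mult_right_mono, auto)
      show "cmod (ell2_nth (L x) k) \<le> \<bar>c'\<bar> * exp (- \<gamma> * real_of_int \<bar>k\<bar>)" for k
        by (rule order_trans[OF y]) (intro mult_right_mono, auto)
    qed
    then have "(1 + \<kappa>) * norm (ell2_tail n x) \<le> (1 + \<kappa>) * (K * exp (- \<delta> * real n))"
      using condition_number_nonneg[OF L] \<kappa> by (intro mult_left_mono) auto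
    then have "norm (x - section_solution a (L x) n) \<le> ((1 + \<kappa>) * K) * exp (- \<delta> * real n)"
      using section_error_le_tail[OF L, of x n] \<kappa> by (simp add: mult.assoc)
    also have "\<dots> \<le> R * exp (- \<gamma>\<^sub>1 * real n)"
      using \<gamma>\<^sub>1 R by (intro mult_mono) (auto simp: R_def intro!: mult_right_mono)
    also have "\<dots> \<le> 1 / \<gamma>\<^sub>1 * exp (- \<gamma>\<^sub>1 * real n)"
      by (intro mult_right_mono R\<gamma>) simp
    finally show ?thesis .
  qed
  have "\<gamma>\<^sub>1 < \<gamma>" using \<gamma>\<^sub>1 \<delta> by simp
  with \<gamma>\<^sub>1(1) main show ?thesis by blast
qed

text \<open>The tail constant is obtained for every real \<kappa>, and choice turns it into a
  function \<open>K\<close>. Evaluating it at the condition number gives one function C for all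
  operators with the prescribed norm and decay bounds.\<close>

lemma poly_section_error:
  fixes s c c' \<nu> :: real
  assumes s: "1 < s"
  shows "\<exists>C :: real \<Rightarrow> real. \<forall>a L x y. toeplitz_operator a L \<longrightarrow>
    hermitian_positive_definite L \<longrightarrow> L x = y \<longrightarrow> onorm L = \<nu> \<longrightarrow>
    (\<forall>k. cmod (a k) \<le> c * (1 + real_of_int \<bar>k\<bar>) powr - s) \<longrightarrow>
    (\<forall>k. cmod (ell2_nth y k) \<le> c' * (1 + real_of_int \<bar>k\<bar>) powr - s) \<longrightarrow>
    (\<forall>n\<ge>1. norm (x - section_solution a y n)
      \<le> C (condition_number L) * real n powr ((1 - 2 * s) / 2))"
proof -
  have "\<exists>K. \<forall>a L x. toeplitz_operator a L \<longrightarrow>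
    (\<forall>u. norm u \<le> \<bar>\<kappa> / \<nu>\<bar> * norm (L u)) \<longrightarrow>
    (\<forall>k. cmod (a k) \<le> \<bar>c\<bar> * (1 + real_of_int \<bar>k\<bar>) powr - s) \<longrightarrow>
    (\<forall>k. cmod (ell2_nth (L x) k) \<le> \<bar>c'\<bar> * (1 + real_of_int \<bar>k\<bar>) powr - s) \<longrightarrow>
    (\<forall>n\<ge>1. norm (ell2_tail n x) \<le> K * real n powr (1 / 2 - s))" for \<kappa>
    using poly_tail_decay[OF s abs_ge_zero[of c] abs_ge_zero[of c'] abs_ge_zero[of "\<kappa> / \<nu>"]] .
  then obtain K where K: "\<And>\<kappa> a L x n. toeplitz_operator a L \<Longrightarrow>
    (\<And>u. norm u \<le> \<bar>\<kappa> / \<nu>\<bar> * norm (L u)) \<Longrightarrow>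
    (\<And>k. cmod (a k) \<le> \<bar>c\<bar> * (1 + real_of_int \<bar>k\<bar>) powr - s) \<Longrightarrow>
    (\<And>k. cmod (ell2_nth (L x) k) \<le> \<bar>c'\<bar> * (1 + real_of_int \<bar>k\<bar>) powr - s) \<Longrightarrow>
    1 \<le> n \<Longrightarrow> norm (ell2_tail n x) \<le> K \<kappa> * real n powr (1 / 2 - s)"
    by metis
  have "norm (x - section_solution a (L x) n)
      \<le> (1 + condition_number L) * K (condition_number L) * real n powr ((1 - 2 * s) / 2)"
    if L: "toeplitz_operator a L" "hermitian_positive_definite L" and \<nu>: "onorm L = \<nu>"
      and a: "\<And>k. cmod (a k) \<le> c * (1 + real_of_int \<bar>k\<bar>) powr - s"
      and y: "\<And>k. cmod (ell2_nth (L x) k) \<le> c' * (1 + real_of_int \<bar>k\<bar>) powr - s"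
      and n: "1 \<le> n"
    for a L x n
  proof -
    have "norm (ell2_tail n x) \<le> K (condition_number L) * real n powr (1 / 2 - s)"
    proof (rule K[OF L(1) _ _ _ n])
      show "norm u \<le> \<bar>condition_number L / \<nu>\<bar> * norm (L u)" for u
        using hermitian_positive_definite_norm_le_condition[OF L, of u] by (simp add: \<nu>)
      show "cmod (a k) \<le> \<bar>c\<bar> * (1 + real_of_int \<bar>k\<bar>) powr - s" for k
        by (rule order_trans[OF a]) (intro mult_right_mono, auto)
      show "cmod (ell2_nth (L x) k) \<le> \<bar>c'\<bar> * (1 + real_of_int \<bar>k\<bar>) powr - s" for k
        by (rule order_trans[OF y]) (intro mult_right_mono, auto)
    qed
    then have "(1 + condition_number L) * norm (ell2_tail n x)
        \<le> (1 + condition_number L) * (K (condition_number L) * real n powr (1 / 2 - s))"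
      using condition_number_nonneg[OF L] by (intro mult_left_mono) auto
    also have "1 / 2 - s = (1 - 2 * s) / 2" by (simp add: field_simps)
    finally show ?thesis
      using section_error_le_tail[OF L, of x n] by (simp add: mult.assoc)
  qed
  then show ?thesis
    by (intro exI[of _ "\<lambda>\<kappa>. (1 + \<kappa>) * K \<kappa>"]) blast
qed

theorem theorem3p1:
  shows
    "(\<exists>C :: real \<Rightarrow> real \<Rightarrow> real.
        \<forall>(\<gamma> :: real) (c :: real) (c' :: real) (\<nu> :: real) (\<kappa> :: real). \<gamma> > 0 \<longrightarrow>
          (\<exists>\<gamma>\<^sub>1. 0 < \<gamma>\<^sub>1 \<and> \<gamma>\<^sub>1 < \<gamma> \<and>
            (\<forall>(a :: int \<Rightarrow> complex) (L :: ell2 \<Rightarrow> ell2) (x :: ell2) (y :: ell2).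
               toeplitz_operator a L \<longrightarrow> hermitian_positive_definite L \<longrightarrow> L x = y \<longrightarrow>
               onorm L = \<nu> \<longrightarrow> condition_number L = \<kappa> \<longrightarrow>
               (\<forall>k. cmod (a k) \<le> c * exp (- \<gamma> * real_of_int \<bar>k\<bar>)) \<longrightarrow>
               (\<forall>k. cmod (ell2_nth y k) \<le> c' * exp (- \<gamma> * real_of_int \<bar>k\<bar>)) \<longrightarrow>
               (\<forall>n\<ge>1. norm (x - section_solution a y n)
                        \<le> C \<gamma>\<^sub>1 (condition_number L) * exp (- \<gamma>\<^sub>1 * real n)))))
     \<and>
     (\<forall>(s :: real) (c :: real) (c' :: real) (\<nu> :: real). s > 1 \<longrightarrow>
        (\<exists>C :: real \<Rightarrow> real.
            \<forall>(a :: int \<Rightarrow> complex) (L :: ell2 \<Rightarrow> ell2) (x :: ell2) (y :: ell2).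
               toeplitz_operator a L \<longrightarrow> hermitian_positive_definite L \<longrightarrow> L x = y \<longrightarrow>
               onorm L = \<nu> \<longrightarrow>
               (\<forall>k. cmod (a k) \<le> c * (1 + real_of_int \<bar>k\<bar>) powr (- s)) \<longrightarrow>
               (\<forall>k. cmod (ell2_nth y k) \<le> c' * (1 + real_of_int \<bar>k\<bar>) powr (- s)) \<longrightarrow>
               (\<forall>n\<ge>1. norm (x - section_solution a y n)
                        \<le> C (condition_number L) * real n powr ((1 - 2 * s) / 2))))"
  by (rule conjI, rule exI[of _ "\<lambda>\<gamma>\<^sub>1 _. 1 / \<gamma>\<^sub>1"])
    (intro allI impI, erule exp_section_error, intro allI impI, erule poly_section_error)

end
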